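(* Let $p$ and $k\geqslant 1$ be integers with $p\geqslant 2k$, let $\sigma\geqslant 0$, and let $w^\star\in\{0,1\}^p$ with $\|w^\star\|_0=k$. Let the data be generated according to $y_i=\mathrm{sign}(x_i^\top w^\star+\varepsilon_i)$, $i=1,\dots,n$, where $x_1,\dots,x_n$ are i.i.d. standard Gaussian vectors in $\mathbb{R}^p$ and $\varepsilon_1,\dots,\varepsilon_n$ are i.i.d. $\mathcal{N}(0,\sigma^2)$ random variables independent of the $x_i$. For a classifier $w$ let $\hat y_i(w):=\mathrm{sign}(x_i^\top w)$, and for any two binary classifiers $w_1,w_2\in\{0,1\}^p$ let $$\Delta(w_1,w_2):=\frac1n\sum_{i=1}^n\Big(\mathbf{1}(\hat y_i(w_1)\neq y_i)-\mathbf{1}(\hat y_i(w_2)\neq y_i)\Big).$$ Then there exists a threshold $n_0>0$ such that for any $n>n_0$, $$\mathbb{P}\Big(\exists\, w\neq w^\star,\ w\in\{0,1\}^p,\ \|w\|_0=k \text{ s.t. } \Delta(w,w^\star)\leqslant 0\Big)\leqslant \exp\left(-\frac{n-n_0}{2\pi^2k(\sigma^2+2)}\right).$$ Moreover, $n_0< C\,(2+\sigma^2)\,k\log(p-k)$ for some absolute constant $C>0$. In other words, if $n\geqslant C(2+\sigma^2)k\log(p-k)+2\pi^2k(\sigma^2+2)\log(1/\delta)$ for some $\delta\in(0,1)$, then $$\mathbb{P}\Big(\exists\, w\neq w^\star,\ w\in\{0,1\}^p,\ \|w\|_0=k \text{ s.t. } \Delta(w,w^\star)\leqslant 0\Big)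\leqslant\delta.$$
   Context: $\|w\|_0$ denotes the number of nonzero entries of $w$. The sign function is $\mathrm{sign}(\lambda)=1$ if $\lambda>0$ and $\mathrm{sign}(\lambda)=-1$ otherwise. $\mathbf{1}(\cdot)$ denotes the indicator of an event. $\mathcal{N}(0,\sigma^2)$ is the normal distribution with mean $0$ and variance $\sigma^2$ (the point mass at $0$ if $\sigma=0$). "Absolute constant" means that $C$ does not depend on $n,p,k,\sigma$ or $w^\star$; the threshold $n_0$ does not depend on $n$.
   Formalization: The bound n_0 < C(2+σ²)k log(p−k) is asserted only when p−k > 1; in the sole excluded case p=2, k=1 it would read 0 < n_0 < 0, which is impossible. All other claims are kept in that case. *)

theory Defs
  imports "HOL-Probability.Probability"
begin

text \<open>
  Vectors in \<open>\<real>\<^sup>p\<close> are functions on \<open>{..<p}\<close>, extended by \<open>undefined\<close> outside (the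
  carrier of \<open>\<Pi>\<^sub>M j\<in>{..<p}. borel\<close>), so that equality of vectors is equality of functions.
\<close>

definition binary_vectors :: "nat \<Rightarrow> (nat \<Rightarrow> real) set" where
  "binary_vectors p = {..<p} \<rightarrow>\<^sub>E {0, 1}"

definition l0_norm :: "nat \<Rightarrow> (nat \<Rightarrow> real) \<Rightarrow> nat" where
  "l0_norm p w = card {j \<in> {..<p}. w j \<noteq> 0}"

definition dot :: "nat \<Rightarrow> (nat \<Rightarrow> real) \<Rightarrow> (nat \<Rightarrow> real) \<Rightarrow> real" where
  "dot p x w = (\<Sum>j<p. x j * w j)"

text \<open>Unlike \<^const>\<open>sgn\<close>, this takes the value \<open>-1\<close> at \<open>0\<close>.\<close>

definition bsign :: "real \<Rightarrow> real" where
  "bsign t = (if t > 0 then 1 else -1)"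

definition classify :: "nat \<Rightarrow> (nat \<Rightarrow> real) \<Rightarrow> (nat \<Rightarrow> real) \<Rightarrow> real" where
  "classify p w x = bsign (dot p x w)"

definition noisy_label :: "nat \<Rightarrow> (nat \<Rightarrow> real) \<Rightarrow> (nat \<Rightarrow> real) \<Rightarrow> real \<Rightarrow> real" where
  "noisy_label p w x e = bsign (dot p x w + e)"

definition err_diff ::
  "nat \<Rightarrow> nat \<Rightarrow> (nat \<Rightarrow> nat \<Rightarrow> real) \<Rightarrow> (nat \<Rightarrow> real) \<Rightarrow> (nat \<Rightarrow> real) \<Rightarrow> (nat \<Rightarrow> real) \<Rightarrow> real"
where
  "err_diff n p x y w1 w2 =
     (1 / real n) *
     (\<Sum>i<n. of_bool (classify p w1 (x i) \<noteq> y i) - of_bool (classify p w2 (x i) \<noteq> y i))"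

text \<open>The second argument of \<^const>\<open>normal_density\<close> is the standard deviation.\<close>

definition centered_normal :: "real \<Rightarrow> real measure" where
  "centered_normal \<sigma> =
     (if \<sigma> = 0 then return borel 0 else density lborel (\<lambda>t. ennreal (normal_density 0 \<sigma> t)))"

definition std_gaussian :: "nat \<Rightarrow> (nat \<Rightarrow> real) measure" where
  "std_gaussian p = (\<Pi>\<^sub>M j\<in>{..<p}. centered_normal 1)"

text \<open>
  The last assumption says that the noise family is independent of the design family; it is stated
  through the generated \<open>\<sigma>\<close>-algebras because \<^const>\<open>prob_space.indep_var\<close> needs both
  variables to have the same value type.
\<close>

locale gaussian_sample = prob_space M
  for M :: "'a measure" +
  fixes n p :: nat and \<sigma> :: real
    and X :: "nat \<Rightarrow> 'a \<Rightarrow> nat \<Rightarrow> real" and E :: "nat \<Rightarrow> 'a \<Rightarrow> real"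
  assumes X_indep: "indep_vars (\<lambda>_. \<Pi>\<^sub>M j\<in>{..<p}. borel) X {..<n}"
    and X_law: "\<And>i. i < n \<Longrightarrow> distr M (\<Pi>\<^sub>M j\<in>{..<p}. borel) (X i) = std_gaussian p"
    and E_indep: "indep_vars (\<lambda>_. borel) E {..<n}"
    and E_law: "\<And>i. i < n \<Longrightarrow> distr M borel (E i) = centered_normal \<sigma>"
    and X_E_indep:
      "indep_set
         (sets (vimage_algebra (space M) (\<lambda>\<omega>. \<lambda>i\<in>{..<n}. X i \<omega>)
                  (\<Pi>\<^sub>M i\<in>{..<n}. \<Pi>\<^sub>M j\<in>{..<p}. borel)))
         (sets (vimage_algebra (space M) (\<lambda>\<omega>. \<lambda>i\<in>{..<n}. E i \<omega>)
                  (\<Pi>\<^sub>M i\<in>{..<n}. borel)))"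

definition failure_event ::
  "'a measure \<Rightarrow> nat \<Rightarrow> nat \<Rightarrow> nat \<Rightarrow> (nat \<Rightarrow> real) \<Rightarrow>
   (nat \<Rightarrow> 'a \<Rightarrow> nat \<Rightarrow> real) \<Rightarrow> (nat \<Rightarrow> 'a \<Rightarrow> real) \<Rightarrow> 'a set"
where
  "failure_event M n p k w X E =
     {\<omega> \<in> space M. \<exists>v \<in> binary_vectors p. v \<noteq> w \<and> l0_norm p v = k \<and>
        err_diff n p (\<lambda>i. X i \<omega>) (\<lambda>i. noisy_label p w (X i \<omega>) (E i \<omega>)) v w \<le> 0}"

end

theory Submission
  imports Defs "HOL-Real_Asymp.Real_Asymp"
begin

text \<open>
  Let \<open>d\<close> be the number of ones of \<open>w*\<close> missed by a competitor \<open>w\<close>. Both error probabilities are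
  angles divided by \<open>\<pi>\<close>, namely of the pairs \<open>(x\<^sup>T w, x\<^sup>T w* + \<epsilon>)\<close> and \<open>(x\<^sup>T w*, x\<^sup>T w* + \<epsilon>)\<close>, so with
  \<open>N\<^sup>2 = k (k + \<sigma>\<^sup>2)\<close> the mean of \<open>\<Delta>\<close> is \<open>(arccos ((k - d) / N) - arccos (k / N)) / \<pi>\<close>. By the mean value
  theorem this is at least \<open>d / (\<pi> sqrt (N\<^sup>2 - (k - d)\<^sup>2)) \<ge> sqrt (d / (k (\<sigma>\<^sup>2 + 2))) / \<pi>\<close>, and Hoeffding's
  inequality bounds the failure probability of \<open>w\<close> by \<open>exp (- n d / A)\<close> with \<open>A = 2 \<pi>\<^sup>2 k (\<sigma>\<^sup>2 + 2)\<close>. As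
  there are at most \<open>(p - k)\<^bsup>2d\<^esup>\<close> competitors missing \<open>d\<close> ones, the union bound is a geometric
  series, and \<open>n\<^sub>0 = A ln (2 (p - k)\<^sup>2)\<close> works.
\<close>

section \<open>Centered normal laws\<close>

text \<open>Indexed by the variance, so that independent sums add the parameters. The value
  \<open>0\<close> gives the point mass, which keeps noiseless labels and empty blocks within the
  same formulas.\<close>

abbreviation gauss :: "real \<Rightarrow> real measure" where
  "gauss v \<equiv> centered_normal (sqrt v)"

lemma sets_centered_normal [measurable_cong, simp]: "sets (centered_normal s) = sets borel"
  by (simp add: centered_normal_def)

lemma space_centered_normal [simp]: "space (centered_normal s) = UNIV"
  by (simp add: centered_normal_def)

lemma prob_space_centered_normal: "s \<ge> 0 \<Longrightarrow> prob_space (centered_normal s)"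
  by (auto simp: centered_normal_def intro!: prob_space_return prob_space_normal_density)

lemma nn_integral_gauss_0:
  assumes [measurable]: "f \<in> borel_measurable borel"
  shows "(\<integral>\<^sup>+x. f x \<partial>gauss 0) = f 0"
  by (simp add: centered_normal_def nn_integral_return)

lemma nn_integral_gauss:
  assumes [measurable]: "f \<in> borel_measurable borel" and "v > 0"
  shows "(\<integral>\<^sup>+x. f x \<partial>gauss v) = (\<integral>\<^sup>+x. ennreal (normal_density 0 (sqrt v) x) * f x \<partial>lborel)"
  using assms(2) by (simp add: centered_normal_def nn_integral_density)

lemma normal_density_sqrt: "v \<ge> 0 \<Longrightarrow> normal_density 0 (sqrt v) x = exp (- x\<^sup>2 / (2 * v)) / sqrt (2 * pi * v)"
  by (simp add: normal_density_def)

text \<open>For independent \<open>x\<close>, \<open>y\<close> of variances \<open>v\<close>,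
  \<open>w\<close>, the variables \<open>u = x + y\<close> and \<open>z = w * x - v * y\<close> are
  uncorrelated, with variances \<open>v + w\<close> and \<open>v * w * (v + w)\<close>. The
  arguments on the left are \<open>x\<close> and \<open>y\<close> recovered from \<open>u\<close>
  and \<open>z\<close>, and \<open>1 / (v + w)\<close> is the Jacobian factor.\<close>

lemma normal_density_rotate:
  assumes "v > 0" "w > 0"
  shows "normal_density 0 (sqrt v) ((v * u + z) / (v + w)) * normal_density 0 (sqrt w) ((w * u - z) / (v + w)) / (v + w)
    = normal_density 0 (sqrt (v + w)) u * normal_density 0 (sqrt (v * w * (v + w))) z"
proof -
  have vw: "v + w > 0" using assms by simp
  have "((v * u + z) / (v + w))\<^sup>2 / (2 * v) + ((w * u - z) / (v + w))\<^sup>2 / (2 * w)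
      = (w * (v * u + z)\<^sup>2 + v * (w * u - z)\<^sup>2) / (2 * v * w * (v + w)\<^sup>2)"
    using assms vw by (simp add: divide_simps power2_eq_square)
  \<comment> \<open>The mixed terms in \<open>u * z\<close> cancel: this is the vanishing
    covariance.\<close>
  also have "w * (v * u + z)\<^sup>2 + v * (w * u - z)\<^sup>2 = (v + w) * (v * w * u\<^sup>2 + z\<^sup>2)"
    by (simp add: algebra_simps power2_eq_square)
  also have "\<dots> / (2 * v * w * (v + w)\<^sup>2) = (v * w * u\<^sup>2 + z\<^sup>2) / (2 * v * w * (v + w))"
    using assms vw by (simp add: divide_simps) (simp add: algebra_simps power2_eq_square)
  also have "\<dots> = u\<^sup>2 / (2 * (v + w)) + z\<^sup>2 / (2 * (v * w * (v + w)))"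
    using assms vw by (simp add: divide_simps) (simp add: algebra_simps)
  finally have e: "- (((v * u + z) / (v + w))\<^sup>2 / (2 * v)) - ((w * u - z) / (v + w))\<^sup>2 / (2 * w)
      = - (u\<^sup>2 / (2 * (v + w))) - z\<^sup>2 / (2 * (v * w * (v + w)))" by simp
  have s: "sqrt (2 * pi * v) * sqrt (2 * pi * w) * (v + w) = sqrt (2 * pi * (v + w)) * sqrt (2 * pi * (v * w * (v + w)))"
    using vw real_sqrt_mult_self[of "v + w"] unfolding real_sqrt_mult by (simp add: mult_ac)
  have "exp (- (((v * u + z) / (v + w))\<^sup>2) / (2 * v)) * exp (- (((w * u - z) / (v + w))\<^sup>2) / (2 * w))
      = exp (- (u\<^sup>2) / (2 * (v + w))) * exp (- z\<^sup>2 / (2 * (v * w * (v + w))))"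
    using e by (simp flip: exp_add)
  with s show ?thesis using assms
    by (simp add: normal_density_sqrt)
qed

text \<open>Uncorrelated combinations of independent Gaussians are independent. The form with
  nonnegative integrals needs no integrability and applies directly to indicators.\<close>

lemma nn_integral_gauss_rotate:
  fixes h :: "real \<times> real \<Rightarrow> ennreal"
  assumes h[measurable]: "h \<in> borel_measurable (borel \<Otimes>\<^sub>M borel)" and "v \<ge> 0" "w \<ge> 0"
  shows "(\<integral>\<^sup>+x. \<integral>\<^sup>+y. h (x + y, w * x - v * y) \<partial>gauss w \<partial>gauss v)
    = (\<integral>\<^sup>+u. \<integral>\<^sup>+z. h (u, z) \<partial>gauss (v * w * (v + w)) \<partial>gauss (v + w))"
proof -
  \<comment> \<open>A zero variance gives a point mass, which has no density; those cases are
    evaluated directly.\<close>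
  consider "v = 0" | "w = 0" | "v > 0" "w > 0" using assms by linarith
  then show ?thesis
  proof cases
    case 1
    interpret w: prob_space "gauss w" using assms by (simp add: prob_space_centered_normal)
    have "(\<lambda>x. \<integral>\<^sup>+y. h (x + y, w * x - v * y) \<partial>gauss w) \<in> borel_measurable borel" by measurable
    then have "(\<integral>\<^sup>+x. \<integral>\<^sup>+y. h (x + y, w * x - v * y) \<partial>gauss w \<partial>gauss v) = (\<integral>\<^sup>+y. h (y, 0) \<partial>gauss w)"
      using 1 by (simp only: nn_integral_gauss_0) simp
    then show ?thesis using 1 by (simp add: nn_integral_gauss_0 del: real_sqrt_zero)
  next
    case 2
    then show ?thesis by (simp add: nn_integral_gauss_0 del: real_sqrt_zero)
  next
    case 3
    define f g where "f = normal_density 0 (sqrt v)" and "g = normal_density 0 (sqrt w)"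
    have [measurable]: "f \<in> borel_measurable borel" "g \<in> borel_measurable borel" by (simp_all add: f_def g_def)
    have nn: "f x \<ge> 0" "g x \<ge> 0" for x by (simp_all add: f_def g_def)
    have vw: "v + w > 0" "v * w * (v + w) > 0" using 3 by simp_all
    interpret w: prob_space "gauss w" using assms by (simp add: prob_space_centered_normal)
    interpret vw: prob_space "gauss (v * w * (v + w))" using assms by (simp add: prob_space_centered_normal)
    have "(\<integral>\<^sup>+x. \<integral>\<^sup>+y. h (x + y, w * x - v * y) \<partial>gauss w \<partial>gauss v)
       = (\<integral>\<^sup>+x. f x * (\<integral>\<^sup>+y. h (x + y, w * x - v * y) \<partial>gauss w) \<partial>lborel)"
      unfolding f_def using 3 by (subst nn_integral_gauss) auto
    also have "\<dots> = (\<integral>\<^sup>+x. f x * (\<integral>\<^sup>+y. g y * h (x + y, w * x - v * y) \<partial>lborel) \<partial>lborel)"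
      unfolding g_def using 3 by (subst nn_integral_gauss) auto
    also have "\<dots> = (\<integral>\<^sup>+x. \<integral>\<^sup>+y. f x * (g y * h (x + y, w * x - v * y)) \<partial>lborel \<partial>lborel)"
      by (simp add: nn_integral_cmult)
    \<comment> \<open>Integrating over \<open>x\<close> first allows the shift
      \<open>x = u - y\<close>; exchanging back afterwards fixes \<open>u\<close> for the
      substitution in \<open>y\<close>.\<close>
    also have "\<dots> = (\<integral>\<^sup>+y. \<integral>\<^sup>+x. f x * (g y * h (x + y, w * x - v * y)) \<partial>lborel \<partial>lborel)"
      by (rule lborel_pair.Fubini') measurable
    also have "\<dots> = (\<integral>\<^sup>+y. \<integral>\<^sup>+u. f (u - y) * (g y * h (u, w * (u - y) - v * y)) \<partial>lborel \<partial>lborel)"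
    proof (rule nn_integral_cong)
      fix y :: real
      show "(\<integral>\<^sup>+x. f x * (g y * h (x + y, w * x - v * y)) \<partial>lborel)
        = (\<integral>\<^sup>+u. f (u - y) * (g y * h (u, w * (u - y) - v * y)) \<partial>lborel)"
        by (subst nn_integral_real_affine[where c = 1 and t = "- y"]) simp_all
    qed
    also have "\<dots> = (\<integral>\<^sup>+u. \<integral>\<^sup>+y. f (u - y) * (g y * h (u, w * (u - y) - v * y)) \<partial>lborel \<partial>lborel)"
      by (rule lborel_pair.Fubini') measurable
    also have "\<dots> = (\<integral>\<^sup>+u. \<integral>\<^sup>+z. ennreal (normal_density 0 (sqrt (v + w)) u) *
        (ennreal (normal_density 0 (sqrt (v * w * (v + w))) z) * h (u, z)) \<partial>lborel \<partial>lborel)"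
    proof (rule nn_integral_cong)
      fix u :: real
      \<comment> \<open>At fixed \<open>u\<close> the substitution is
        \<open>y = (w * u - z) / (v + w)\<close>; its factor \<open>1 / (v + w)\<close> is the one
        absorbed by \<open>normal_density_rotate\<close>.\<close>
      have yeq: "w * u / (v + w) + -1 / (v + w) * z = (w * u - z) / (v + w)" for z
        by (simp add: diff_divide_distrib)
      have ueq: "u - (w * u - z) / (v + w) = (v * u + z) / (v + w)" for z
        using vw by (simp add: divide_simps) (simp add: algebra_simps)
      have zeq: "w * ((v * u + z) / (v + w)) - v * ((w * u - z) / (v + w)) = z" for z
        using vw by (simp add: divide_simps) (simp add: algebra_simps)
      have "(\<integral>\<^sup>+y. f (u - y) * (g y * h (u, w * (u - y) - v * y)) \<partial>lborel)
        = \<bar>-1 / (v + w)\<bar> * (\<integral>\<^sup>+z. f ((v * u + z) / (v + w)) * (g ((w * u - z) / (v + w)) * h (u, z)) \<partial>lborel)"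
        using vw by (subst nn_integral_real_affine[where c = "-1 / (v + w)" and t = "w * u / (v + w)"])
          (simp_all only: yeq ueq zeq, auto)
      also have "\<dots> = (\<integral>\<^sup>+z. ennreal (f ((v * u + z) / (v + w)) * g ((w * u - z) / (v + w)) / (v + w)) * h (u, z) \<partial>lborel)"
        using vw nn by (subst nn_integral_cmult[symmetric]) (auto intro!: nn_integral_cong simp: mult.assoc[symmetric] simp flip: ennreal_mult)
      finally show "(\<integral>\<^sup>+y. f (u - y) * (g y * h (u, w * (u - y) - v * y)) \<partial>lborel) = (\<integral>\<^sup>+z. ennreal (normal_density 0 (sqrt (v + w)) u) *
        (ennreal (normal_density 0 (sqrt (v * w * (v + w))) z) * h (u, z)) \<partial>lborel)"
        unfolding f_def g_def normal_density_rotate[OF 3] by (simp add: ennreal_mult mult.assoc)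
    qed
    also have "\<dots> = (\<integral>\<^sup>+u. ennreal (normal_density 0 (sqrt (v + w)) u) * (\<integral>\<^sup>+z. h (u, z) \<partial>gauss (v * w * (v + w))) \<partial>lborel)"
      using vw by (intro nn_integral_cong) (auto simp: nn_integral_cmult nn_integral_gauss)
    also have "\<dots> = (\<integral>\<^sup>+u. \<integral>\<^sup>+z. h (u, z) \<partial>gauss (v * w * (v + w)) \<partial>gauss (v + w))"
      using vw by (subst nn_integral_gauss[of _ "v + w"]) auto
    finally show ?thesis .
  qed
qed

text \<open>The second coordinate of the rotated pair integrates out with total mass one.\<close>

lemma nn_integral_gauss_add:
  assumes [measurable]: "f \<in> borel_measurable borel" and "v \<ge> 0" "w \<ge> 0"
  shows "(\<integral>\<^sup>+x. \<integral>\<^sup>+y. f (x + y) \<partial>gauss w \<partial>gauss v) = (\<integral>\<^sup>+u. f u \<partial>gauss (v + w))"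
proof -
  interpret vw: prob_space "gauss (v * w * (v + w))" using assms by (simp add: prob_space_centered_normal)
  show ?thesis using nn_integral_gauss_rotate[of "\<lambda>p. f (fst p)" v w] assms vw.emeasure_space_1 by simp
qed

text \<open>A linear substitution in the density; the sign of \<open>c\<close> disappears by
  symmetry of the law. If \<open>c\<close> or \<open>v\<close> is zero, both sides reduce to the
  value at \<open>0\<close>.\<close>

lemma nn_integral_gauss_scale:
  assumes [measurable]: "f \<in> borel_measurable borel" and "v \<ge> 0"
  shows "(\<integral>\<^sup>+x. f (c * x) \<partial>gauss v) = (\<integral>\<^sup>+x. f x \<partial>gauss (c\<^sup>2 * v))"
proof -
  consider "c = 0" | "v = 0" | "c \<noteq> 0" "v > 0" using assms by linarith
  then show ?thesis
  proof cases
    case 1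
    interpret v: prob_space "gauss v" using assms by (simp add: prob_space_centered_normal)
    from 1 show ?thesis using v.emeasure_space_1 by (simp add: nn_integral_gauss_0 del: real_sqrt_zero)
  next
    case 2
    then show ?thesis by (simp add: nn_integral_gauss_0 del: real_sqrt_zero)
  next
    case 3
    have d: "normal_density 0 (sqrt (c\<^sup>2 * v)) (c * x) * \<bar>c\<bar> = normal_density 0 (sqrt v) x" for x
      using 3 by (simp add: normal_density_def real_sqrt_mult power_mult_distrib)
    have "(\<integral>\<^sup>+x. f x \<partial>gauss (c\<^sup>2 * v)) = (\<integral>\<^sup>+x. ennreal (normal_density 0 (sqrt (c\<^sup>2 * v)) x) * f x \<partial>lborel)"
      using 3 by (intro nn_integral_gauss) auto
    also have "\<dots> = \<bar>c\<bar> * (\<integral>\<^sup>+x. ennreal (normal_density 0 (sqrt (c\<^sup>2 * v)) (c * x)) * f (c * x) \<partial>lborel)"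
      using 3 by (subst nn_integral_real_affine[where c = c and t = 0]) auto
    also have "\<dots> = (\<integral>\<^sup>+x. ennreal (normal_density 0 (sqrt (c\<^sup>2 * v)) (c * x) * \<bar>c\<bar>) * f (c * x) \<partial>lborel)"
      by (subst nn_integral_cmult[symmetric]) (auto intro!: nn_integral_cong simp: ennreal_mult mult_ac)
    also have "\<dots> = (\<integral>\<^sup>+x. f (c * x) \<partial>gauss v)"
      using 3 unfolding d by (subst nn_integral_gauss) auto
    finally show ?thesis by simp
  qed
qed

section \<open>Sign disagreement of Gaussian pairs\<close>

lemma measurable_bsign [measurable]: "bsign \<in> borel_measurable borel"
  unfolding bsign_def[abs_def] by measurable

text \<open>Translates a slope \<open>t\<close> into a correlation: integration produces an
  \<open>arctan\<close>, while the later estimates use the angle as an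
  \<open>arccos\<close>.\<close>

lemma arccos_eq_arctan: "arccos (t / sqrt (1 + t\<^sup>2)) = pi / 2 - arctan t"
proof -
  have "cos (pi / 2 - arctan t) = t / sqrt (1 + t\<^sup>2)"
    by (simp add: cos_diff sin_arctan)
  moreover have "0 \<le> pi / 2 - arctan t" "pi / 2 - arctan t \<le> pi"
    using arctan_lbound[of t] arctan_ubound[of t] by linarith+
  ultimately show ?thesis by (metis arccos_cos)
qed

text \<open>The radial integral of the wedge computation, by its explicit antiderivative.\<close>

lemma nn_integral_rayleigh:
  fixes a :: real
  assumes "a > 0"
  shows "(\<integral>\<^sup>+b. ennreal (b * exp (- (a * b\<^sup>2) / 2)) * indicator {0..} b \<partial>lborel) = ennreal (1 / a)"
proof -
  have "(\<integral>\<^sup>+b. ennreal (b * exp (- (a * b\<^sup>2) / 2)) * indicator {0..} b \<partial>lborel)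
     = ennreal (0 - (- exp (- (a * 0\<^sup>2) / 2) / a))"
  proof (rule nn_integral_FTC_atLeast[where F = "\<lambda>b. - exp (- (a * b\<^sup>2) / 2) / a"])
    show "((\<lambda>b. - exp (- (a * b\<^sup>2) / 2) / a) \<longlongrightarrow> 0) at_top"
      using assms by real_asymp
  qed (use assms in \<open>auto intro!: derivative_eq_intros simp: field_simps\<close>)
  then show ?thesis by simp
qed

lemma nn_integral_arctan:
  "(\<integral>\<^sup>+s. ennreal (1 / (1 + s\<^sup>2)) * indicator {t..} s \<partial>lborel) = ennreal (pi / 2 - arctan t)"
proof (rule nn_integral_FTC_atLeast)
  show "(arctan \<longlongrightarrow> pi / 2) at_top" by (rule tendsto_arctan_at_top)
qed (auto intro!: derivative_eq_intros simp: inverse_eq_divide)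

text \<open>The event is a double wedge in the plane. Its two halves have equal mass, and on
  \<open>b > 0\<close> the substitution \<open>z = b * s\<close> by slopes turns the Gaussian
  density into a Rayleigh integral in \<open>b\<close> times a Cauchy density in
  \<open>s\<close>.\<close>

lemma std_wedge_probability:
  "(\<integral>\<^sup>+b. \<integral>\<^sup>+z. of_bool (bsign b \<noteq> bsign (t * b + z)) \<partial>gauss 1 \<partial>gauss 1)
    = ennreal (1 / 2 - arctan t / pi)"
proof -
  let ?\<phi> = std_normal_density
  define \<Psi> where "\<Psi> x = (\<integral>\<^sup>+z. ennreal (?\<phi> z) * indicator {x..} z \<partial>lborel)" for x :: real
  define F where "F b = ennreal (?\<phi> b) * (\<integral>\<^sup>+z. ennreal (?\<phi> z) * of_bool (bsign b \<noteq> bsign (t * b + z)) \<partial>lborel)" for b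
  have [measurable]: "F \<in> borel_measurable borel" unfolding F_def by measurable
  have even: "?\<phi> (- x) = ?\<phi> x" for x by (simp add: normal_density_def)
  interpret prob_space "gauss 1" by (simp add: prob_space_centered_normal)
  \<comment> \<open>For \<open>b > 0\<close> disagreement means \<open>t * b + z \<le> 0\<close>;
    reflecting \<open>z\<close> gives the upper tail from \<open>t * b\<close>.\<close>
  have Fpos: "F b = ennreal (?\<phi> b) * \<Psi> (t * b)" if "b > 0" for b
    unfolding F_def \<Psi>_def using that
    by (subst nn_integral_real_affine[where c = "-1" and t = 0])
       (auto simp: even bsign_def indicator_def intro!: nn_integral_cong arg_cong[where f = "\<lambda>x. _ * x"])
  have Fneg: "F (- b) = ennreal (?\<phi> b) * \<Psi> (t * b)" if "b > 0" for b
  proof -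
    have "(\<integral>\<^sup>+z. ennreal (?\<phi> z) * of_bool (bsign (- b) \<noteq> bsign (t * (- b) + z)) \<partial>lborel) = \<Psi> (t * b)"
      unfolding \<Psi>_def
    \<comment> \<open>Here disagreement is the open half line \<open>z > t * b\<close>, because
      \<open>bsign 0 = -1\<close>; it differs from the closed one by a null set.\<close>
    proof (rule nn_integral_cong_AE)
      show "AE z in lborel. ennreal (?\<phi> z) * of_bool (bsign (- b) \<noteq> bsign (t * (- b) + z)) = ennreal (?\<phi> z) * indicator {t * b..} z"
        using AE_lborel_singleton[of "t * b"] by eventually_elim (use that in \<open>auto simp: bsign_def indicator_def\<close>)
    qed
    then show ?thesis by (simp add: F_def even)
  qed
  have \<Psi>: "ennreal (?\<phi> b) * \<Psi> (t * b)
     = (\<integral>\<^sup>+s. ennreal (b * exp (- ((1 + s\<^sup>2) * b\<^sup>2) / 2) / (2 * pi)) * indicator {t..} s \<partial>lborel)" if "b > 0" for b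
  proof -
    have d: "?\<phi> b * b * ?\<phi> (b * s) = b * exp (- ((1 + s\<^sup>2) * b\<^sup>2) / 2) / (2 * pi)" for s
    proof -
      have "exp (- b\<^sup>2 / 2) * exp (- (b * s)\<^sup>2 / 2) = exp (- ((1 + s\<^sup>2) * b\<^sup>2) / 2)"
        by (simp flip: exp_add add: algebra_simps power_mult_distrib add_divide_distrib)
      then show ?thesis by (simp add: std_normal_density_def)
    qed
    have ind: "indicator {t * b..} (b * s) = (indicator {t..} s :: ennreal)" for s
      using that by (auto simp: indicator_def mult.commute)
    have "\<Psi> (t * b) = ennreal b * (\<integral>\<^sup>+s. ennreal (?\<phi> (b * s)) * indicator {t..} s \<partial>lborel)"
      unfolding \<Psi>_def using that by (subst nn_integral_real_affine[where c = b and t = 0]) (auto simp: ind)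
    then have "ennreal (?\<phi> b) * \<Psi> (t * b) = ennreal (?\<phi> b * b) * (\<integral>\<^sup>+s. ennreal (?\<phi> (b * s)) * indicator {t..} s \<partial>lborel)"
      using that by (simp add: ennreal_mult mult.assoc)
    also have "\<dots> = (\<integral>\<^sup>+s. ennreal (?\<phi> b * b * ?\<phi> (b * s)) * indicator {t..} s \<partial>lborel)"
      using that by (subst nn_integral_cmult[symmetric]) (auto intro!: nn_integral_cong simp: ennreal_mult mult.assoc)
    finally show ?thesis unfolding d .
  qed
  \<comment> \<open>Both ranges are put into indicators so that the order of integration can be
    exchanged. Including \<open>b = 0\<close> is harmless, since the integrand vanishes
    there.\<close>
  define G :: "real \<Rightarrow> real \<Rightarrow> ennreal" where
    "G b s = ennreal (b * exp (- ((1 + s\<^sup>2) * b\<^sup>2) / 2) / (2 * pi)) * indicator {0..} b * indicator {t..} s" for b s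
  have [measurable]: "case_prod G \<in> borel_measurable (borel \<Otimes>\<^sub>M borel)" unfolding G_def by measurable
  have GF: "F b * indicator {0<..} b = (\<integral>\<^sup>+s. G b s \<partial>lborel)" "F (- b) * indicator {0<..} b = (\<integral>\<^sup>+s. G b s \<partial>lborel)" for b
    by (cases "b > 0"; cases "b = 0"; simp add: Fpos Fneg \<Psi> G_def)+
  have "(\<integral>\<^sup>+b. \<integral>\<^sup>+z. of_bool (bsign b \<noteq> bsign (t * b + z)) \<partial>gauss 1 \<partial>gauss 1) = (\<integral>\<^sup>+b. F b \<partial>lborel)"
    using nn_integral_gauss[of _ 1] by (simp add: F_def del: real_sqrt_one) (simp add: F_def)
  also have "\<dots> = (\<integral>\<^sup>+b. F b * indicator {0<..} b + F b * indicator {..<0} b \<partial>lborel)"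
  proof (rule nn_integral_cong_AE)
    show "AE b in lborel. F b = F b * indicator {0<..} b + F b * indicator {..<0} b"
      using AE_lborel_singleton[of 0] by eventually_elim (auto simp: indicator_def)
  qed
  also have "\<dots> = (\<integral>\<^sup>+b. F b * indicator {0<..} b \<partial>lborel) + (\<integral>\<^sup>+b. F b * indicator {..<0} b \<partial>lborel)"
    by (rule nn_integral_add) auto
  also have "(\<integral>\<^sup>+b. F b * indicator {..<0} b \<partial>lborel) = (\<integral>\<^sup>+b. F (- b) * indicator {0<..} b \<partial>lborel)"
    by (subst nn_integral_real_affine[where c = "-1" and t = 0]) (auto intro!: nn_integral_cong simp: indicator_def)
  also have "(\<integral>\<^sup>+b. F b * indicator {0<..} b \<partial>lborel) + (\<integral>\<^sup>+b. F (- b) * indicator {0<..} b \<partial>lborel)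
     = 2 * (\<integral>\<^sup>+b. \<integral>\<^sup>+s. G b s \<partial>lborel \<partial>lborel)"
    unfolding GF by (simp add: mult_2)
  also have "(\<integral>\<^sup>+b. \<integral>\<^sup>+s. G b s \<partial>lborel \<partial>lborel) = (\<integral>\<^sup>+s. \<integral>\<^sup>+b. G b s \<partial>lborel \<partial>lborel)"
    by (rule lborel_pair.Fubini') measurable
  also have "\<dots> = (\<integral>\<^sup>+s. ennreal (1 / (2 * pi)) * (ennreal (1 / (1 + s\<^sup>2)) * indicator {t..} s) \<partial>lborel)"
  proof (rule nn_integral_cong)
    fix s :: real
    have pos: "1 + s\<^sup>2 > 0" by (smt (verit) zero_le_power2)
    have "(\<integral>\<^sup>+b. G b s \<partial>lborel) = (\<integral>\<^sup>+b. ennreal (1 / (2 * pi)) * indicator {t..} s *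
        (ennreal (b * exp (- ((1 + s\<^sup>2) * b\<^sup>2) / 2)) * indicator {0..} b) \<partial>lborel)"
      by (intro nn_integral_cong) (auto simp: G_def indicator_def simp flip: ennreal_mult')
    also have "\<dots> = ennreal (1 / (2 * pi)) * indicator {t..} s * ennreal (1 / (1 + s\<^sup>2))"
      using nn_integral_rayleigh[OF pos] by (subst nn_integral_cmult) auto
    finally show "(\<integral>\<^sup>+b. G b s \<partial>lborel) = ennreal (1 / (2 * pi)) * (ennreal (1 / (1 + s\<^sup>2)) * indicator {t..} s)"
      by (simp add: mult_ac)
  qed
  also have "\<dots> = ennreal (1 / (2 * pi)) * ennreal (pi / 2 - arctan t)"
    by (subst nn_integral_cmult) (auto simp: nn_integral_arctan)
  also have "2 * \<dots> = ennreal (2 * (1 / (2 * pi) * (pi / 2 - arctan t)))"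
    using arctan_ubound[of t] by (simp flip: ennreal_mult ennreal_numeral)
  also have "2 * (1 / (2 * pi) * (pi / 2 - arctan t)) = 1 / 2 - arctan t / pi"
    by (simp add: field_simps)
  finally show ?thesis .
qed

lemma bsign_mult_pos: "a > 0 \<Longrightarrow> bsign (a * x) = bsign x"
  by (simp add: bsign_def zero_less_mult_iff)

text \<open>Scaling both variables to variance one preserves signs and leaves a standard wedge. The
  argument of \<open>arccos\<close> is the correlation of \<open>b\<close> and
  \<open>c * b + z\<close>.\<close>

lemma wedge_probability:
  assumes v: "v > 0" and r: "r \<ge> 0" and c: "c \<ge> 0" "c > 0 \<or> r > 0"
  shows "(\<integral>\<^sup>+b. \<integral>\<^sup>+z. of_bool (bsign b \<noteq> bsign (c * b + z)) \<partial>gauss r \<partial>gauss v)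
    = ennreal (arccos (c * sqrt v / sqrt (c\<^sup>2 * v + r)) / pi)"
proof (cases "r = 0")
  case True
  \<comment> \<open>Without the noise term the second score is a positive multiple of the first, so
    the signs agree and the angle is \<open>arccos 1 = 0\<close>.\<close>
  with c have "c > 0" by simp
  then have "sqrt (c\<^sup>2 * v + r) = c * sqrt v" using True by (simp add: real_sqrt_mult)
  with v \<open>c > 0\<close> True show ?thesis
    by (simp add: nn_integral_gauss_0 bsign_mult_pos del: real_sqrt_zero)
next
  case False
  with r have r: "r > 0" by simp
  interpret R: prob_space "gauss r" using r by (simp add: prob_space_centered_normal)
  interpret S: prob_space "gauss 1" by (simp add: prob_space_centered_normal)
  \<comment> \<open>The slope after both variances are normalised to one.\<close>
  define t where "t = c * sqrt v / sqrt r"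
  have "(\<integral>\<^sup>+b. \<integral>\<^sup>+z. of_bool (bsign b \<noteq> bsign (c * b + z)) \<partial>gauss r \<partial>gauss v)
    = (\<integral>\<^sup>+b. \<integral>\<^sup>+z. of_bool (bsign (sqrt v * b) \<noteq> bsign (c * (sqrt v * b) + z)) \<partial>gauss r \<partial>gauss 1)"
    using v by (subst nn_integral_gauss_scale[where c = "sqrt v" and v = 1]) auto
  also have "\<dots> = (\<integral>\<^sup>+b. \<integral>\<^sup>+z. of_bool (bsign (sqrt v * b) \<noteq> bsign (c * (sqrt v * b) + sqrt r * z)) \<partial>gauss 1 \<partial>gauss 1)"
  proof (rule nn_integral_cong)
    fix b :: real
    show "(\<integral>\<^sup>+z. of_bool (bsign (sqrt v * b) \<noteq> bsign (c * (sqrt v * b) + z)) \<partial>gauss r)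
      = (\<integral>\<^sup>+z. of_bool (bsign (sqrt v * b) \<noteq> bsign (c * (sqrt v * b) + sqrt r * z)) \<partial>gauss 1)"
      using r by (subst nn_integral_gauss_scale[where c = "sqrt r" and v = 1]) auto
  qed
  also have "\<dots> = (\<integral>\<^sup>+b. \<integral>\<^sup>+z. of_bool (bsign b \<noteq> bsign (t * b + z)) \<partial>gauss 1 \<partial>gauss 1)"
  proof -
    have "bsign (c * (sqrt v * b) + sqrt r * z) = bsign (t * b + z)" for b z
      using r bsign_mult_pos[of "sqrt r" "t * b + z"] by (simp add: t_def algebra_simps)
    then show ?thesis using v by (simp add: bsign_mult_pos)
  qed
  also have "\<dots> = ennreal (1 / 2 - arctan t / pi)" by (rule std_wedge_probability)
  also have "1 / 2 - arctan t / pi = arccos (t / sqrt (1 + t\<^sup>2)) / pi"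
    unfolding arccos_eq_arctan by (simp add: field_simps)
  also have "t / sqrt (1 + t\<^sup>2) = c * sqrt v / sqrt (c\<^sup>2 * v + r)"
  proof -
    have "1 + t\<^sup>2 = (c\<^sup>2 * v + r) / r" using r v by (simp add: t_def field_simps power_mult_distrib)
    then show ?thesis using r by (simp add: t_def real_sqrt_divide)
  qed
  finally show ?thesis .
qed

text \<open>Rotating \<open>(s, v)\<close> to \<open>s + v\<close> and the uncorrelated \<open>b s - a v\<close> exhibits the
  second score as a multiple of the first plus independent noise.\<close>

lemma mismatch_probability:
  assumes a: "a \<ge> 0" and b: "b > 0" and c: "c > 0"
  shows "(\<integral>\<^sup>+s. \<integral>\<^sup>+v. \<integral>\<^sup>+w. of_bool (bsign (s + v) \<noteq> bsign (s + w)) \<partial>gauss c \<partial>gauss b \<partial>gauss a)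
    = ennreal (arccos (a / (sqrt (a + b) * sqrt (a + c))) / pi)"
proof -
  interpret C: prob_space "gauss c" using c by (simp add: prob_space_centered_normal)
  define k where "k = a + b"
  have k: "k > 0" using a b by (simp add: k_def)
  define h :: "real \<times> real \<Rightarrow> ennreal" where
    "h p = (\<integral>\<^sup>+w. of_bool (bsign (fst p) \<noteq> bsign (a / k * fst p + snd p / k + w)) \<partial>gauss c)" for p
  have [measurable]: "h \<in> borel_measurable (borel \<Otimes>\<^sub>M borel)" unfolding h_def by measurable
  \<comment> \<open>Recovers \<open>s\<close> from the rotated pair; \<open>a / k\<close> is the
    regression coefficient of \<open>s\<close> on \<open>s + v\<close>.\<close>
  have eq: "a / k * (s + v) + (b * s - a * v) / k = s" for s v
    using k by (simp add: divide_simps) (simp add: k_def algebra_simps)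
  have "(\<integral>\<^sup>+s. \<integral>\<^sup>+v. \<integral>\<^sup>+w. of_bool (bsign (s + v) \<noteq> bsign (s + w)) \<partial>gauss c \<partial>gauss b \<partial>gauss a)
    = (\<integral>\<^sup>+s. \<integral>\<^sup>+v. h (s + v, b * s - a * v) \<partial>gauss b \<partial>gauss a)"
    by (simp only: h_def fst_conv snd_conv eq)
  also have "\<dots> = (\<integral>\<^sup>+u. \<integral>\<^sup>+z. h (u, z) \<partial>gauss (a * b * (a + b)) \<partial>gauss (a + b))"
    using a b by (intro nn_integral_gauss_rotate) auto
  also have "\<dots> = (\<integral>\<^sup>+u. \<integral>\<^sup>+r. of_bool (bsign u \<noteq> bsign (a / k * u + r)) \<partial>gauss (a * b / k + c) \<partial>gauss k)"
    unfolding k_def[symmetric]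
  proof (rule nn_integral_cong)
    fix u :: real
    \<comment> \<open>The regression residual \<open>z / k\<close> has variance
      \<open>a * b / k\<close>; it merges with \<open>w\<close> into a single noise
      variable.\<close>
    define g :: "real \<Rightarrow> ennreal" where "g r = of_bool (bsign u \<noteq> bsign (a / k * u + r))" for r
    have [measurable]: "g \<in> borel_measurable borel" unfolding g_def by measurable
    have "(\<integral>\<^sup>+z. h (u, z) \<partial>gauss (a * b * k)) = (\<integral>\<^sup>+z. (\<integral>\<^sup>+w. g (1 / k * z + w) \<partial>gauss c) \<partial>gauss (a * b * k))"
      by (simp add: h_def g_def add.assoc)
    also have "\<dots> = (\<integral>\<^sup>+z. (\<integral>\<^sup>+w. g (z + w) \<partial>gauss c) \<partial>gauss ((1 / k)\<^sup>2 * (a * b * k)))"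
      using a b k by (intro nn_integral_gauss_scale) auto
    also have "(1 / k)\<^sup>2 * (a * b * k) = a * b / k"
      using k by (simp add: power2_eq_square)
    also have "(\<integral>\<^sup>+z. (\<integral>\<^sup>+w. g (z + w) \<partial>gauss c) \<partial>gauss (a * b / k)) = (\<integral>\<^sup>+r. g r \<partial>gauss (a * b / k + c))"
      using a b c k by (intro nn_integral_gauss_add) auto
    finally show "(\<integral>\<^sup>+z. h (u, z) \<partial>gauss (a * b * k)) = (\<integral>\<^sup>+r. of_bool (bsign u \<noteq> bsign (a / k * u + r)) \<partial>gauss (a * b / k + c))"
      by (simp add: g_def)
  qed
  also have "\<dots> = ennreal (arccos (a / k * sqrt k / sqrt ((a / k)\<^sup>2 * k + (a * b / k + c))) / pi)"
    using a b c k by (intro wedge_probability) (auto simp: add_nonneg_pos)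
  \<comment> \<open>The explained and residual variances of \<open>s\<close> add up to
    \<open>a\<close> again.\<close>
  also have "(a / k)\<^sup>2 * k + (a * b / k + c) = a + c"
    using k by (simp add: divide_simps power2_eq_square) (simp add: k_def algebra_simps)
  also have "a / k * sqrt k / sqrt (a + c) = a / (sqrt k * sqrt (a + c))"
  proof -
    have "a / k * sqrt k = a * (sqrt k / k)" by simp
    also have "sqrt k / k = inverse (sqrt k)" using k by (simp add: sqrt_divide_self_eq)
    finally show ?thesis by (simp only:) (simp add: inverse_eq_divide)
  qed
  finally show ?thesis by (simp add: k_def)
qed

section \<open>Lower bounds for differences of angles\<close>

lemma arccos_gap:
  assumes "0 \<le> x" "x < y" "y \<le> 1"
  shows "(y - x) / sqrt (1 - x\<^sup>2) \<le> arccos x - arccos y"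
proof -
  define \<alpha> \<beta> where "\<alpha> = arccos y" and "\<beta> = arccos x"
  have r: "0 \<le> \<alpha>" "\<beta> \<le> pi / 2" "\<alpha> < \<beta>"
    using assms arccos_lbound[of y] arccos_le_pi2[of x] arccos_less_arccos[of x y] by (simp_all add: \<alpha>_def \<beta>_def)
  have c: "cos \<alpha> = y" "cos \<beta> = x" "sin \<beta> = sqrt (1 - x\<^sup>2)"
    using assms by (auto simp: \<alpha>_def \<beta>_def sin_arccos)
  \<comment> \<open>The mean value theorem is applied to \<open>cos\<close> rather than
    \<open>arccos\<close>, which avoids the singular endpoint \<open>y = 1\<close>. Since
    \<open>\<beta> \<le> pi / 2\<close>, the sine at the intermediate point is at most
    \<open>sin \<beta>\<close>.\<close>
  obtain z where z: "z > \<alpha>" "z < \<beta>" "cos \<beta> - cos \<alpha> = (\<beta> - \<alpha>) * (- sin z)"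
    using MVT2[OF r(3), of cos "\<lambda>x. - sin x"] by (auto intro!: derivative_eq_intros)
  have "sin z \<le> sin \<beta>" using z r by (intro sin_monotone_2pi_le) auto
  then have "(\<beta> - \<alpha>) * sin z \<le> (\<beta> - \<alpha>) * sin \<beta>" using r by (intro mult_left_mono) auto
  then have "y - x \<le> (\<beta> - \<alpha>) * sqrt (1 - x\<^sup>2)"
    using z(3) c by (simp add: algebra_simps)
  moreover have "sqrt (1 - x\<^sup>2) > 0" using assms by (simp add: abs_square_less_1)
  ultimately show ?thesis by (simp add: \<alpha>_def \<beta>_def divide_le_eq)
qed

text \<open>With \<open>N = sqrt k * sqrt (k + s)\<close> the cosines are \<open>(k - d) / N\<close>
  and \<open>k / N\<close>, so \<open>arccos_gap\<close> yields
  \<open>d / sqrt (N\<^sup>2 - (k - d)\<^sup>2)\<close>. It remains to bound the quantity under the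
  root by \<open>d * k * (s + 2)\<close>.\<close>

lemma angle_gap:
  fixes k d s :: real
  assumes "1 \<le> d" "d \<le> k" "0 \<le> s"
  shows "sqrt (d / (k * (s + 2))) \<le> arccos ((k - d) / (sqrt k * sqrt (k + s))) - arccos (sqrt k / sqrt (k + s))"
proof -
  have k: "k > 0" using assms by simp
  define N where "N = sqrt k * sqrt (k + s)"
  have N2: "N\<^sup>2 = k * (k + s)" using k assms by (simp add: N_def power_mult_distrib)
  have N0: "N > 0" using k assms by (simp add: N_def)
  have kN: "sqrt k / sqrt (k + s) = k / N"
    using k by (simp add: N_def real_div_sqrt flip: divide_divide_eq_left)
  have "k\<^sup>2 \<le> N\<^sup>2"
    unfolding N2 using k assms by (simp add: power2_eq_square distrib_left)
  then have "k \<le> N" by (rule power2_le_imp_le) (use N0 in simp)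
  have "d / (k * (s + 2)) \<le> d\<^sup>2 / (N\<^sup>2 - (k - d)\<^sup>2)"
  proof -
    have pos: "N\<^sup>2 - (k - d)\<^sup>2 > 0"
    proof -
      have "N\<^sup>2 - (k - d)\<^sup>2 = k * s + d * k + d * (k - d)" unfolding N2 by (simp add: power2_eq_square algebra_simps)
      then show ?thesis using assms k by (simp add: add_nonneg_pos add_pos_nonneg)
    qed
    have "N\<^sup>2 - (k - d)\<^sup>2 \<le> k * s + 2 * k * d" unfolding N2 by (simp add: power2_eq_square algebra_simps)
    \<comment> \<open>Here \<open>d \<ge> 1\<close> absorbs the noise term:
      \<open>k * s \<le> d * k * s\<close>.\<close>
    also have "\<dots> \<le> d * (k * (s + 2))"
      using mult_right_mono[of 1 d "k * s"] assms k by (simp add: algebra_simps)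
    finally have "d * (N\<^sup>2 - (k - d)\<^sup>2) \<le> d * (d * (k * (s + 2)))" using assms by (intro mult_left_mono) auto
    then show ?thesis using pos assms k by (simp add: divide_simps power2_eq_square mult_ac)
  qed
  then have "sqrt (d / (k * (s + 2))) \<le> d / sqrt (N\<^sup>2 - (k - d)\<^sup>2)"
    using assms real_sqrt_le_mono[of "d / (k * (s + 2))" "d\<^sup>2 / (N\<^sup>2 - (k - d)\<^sup>2)"]
    by (simp add: real_sqrt_divide)
  also have "\<dots> = (k / N - (k - d) / N) / sqrt (1 - ((k - d) / N)\<^sup>2)"
  proof -
    have "1 - ((k - d) / N)\<^sup>2 = (N\<^sup>2 - (k - d)\<^sup>2) / N\<^sup>2" using N0 by (simp only: power_divide) (simp add: diff_divide_distrib)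
    moreover have "k / N - (k - d) / N = d / N" by (simp add: diff_divide_distrib)
    ultimately show ?thesis using N0 by (simp add: real_sqrt_divide)
  qed
  also have "\<dots> \<le> arccos ((k - d) / N) - arccos (k / N)"
    using assms N0 \<open>k \<le> N\<close> by (intro arccos_gap) (auto intro!: divide_strict_right_mono)
  finally show ?thesis by (simp add: kN N_def)
qed

section \<open>Block sums of a Gaussian vector\<close>

lemma product_sigma_finite_centered_normal: "product_sigma_finite (\<lambda>_. centered_normal 1)"
  by (simp add: product_sigma_finite_def prob_space_imp_sigma_finite prob_space_centered_normal)

text \<open>Induction on the block: each new coordinate adds variance one, and the empty sum is the
  point mass \<open>gauss 0\<close>.\<close>

lemma nn_integral_PiM_gauss_sum:
  assumes "finite K" and f: "f \<in> borel_measurable borel"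
  shows "(\<integral>\<^sup>+x. f (\<Sum>j\<in>K. x j) \<partial>(\<Pi>\<^sub>M j\<in>K. centered_normal 1)) = (\<integral>\<^sup>+s. f s \<partial>gauss (card K))"
  using assms
proof (induction K arbitrary: f rule: finite_induct)
  case empty
  interpret product_sigma_finite "\<lambda>_. centered_normal 1" by (rule product_sigma_finite_centered_normal)
  show ?case using empty by (simp add: nn_integral_gauss_0 space_PiM_empty del: real_sqrt_zero)
next
  case (insert i K)
  interpret product_sigma_finite "\<lambda>_. centered_normal 1" by (rule product_sigma_finite_centered_normal)
  interpret N: prob_space "centered_normal 1" by (simp add: prob_space_centered_normal)
  note [measurable] = insert.prems
  have "(\<integral>\<^sup>+x. f (\<Sum>j\<in>insert i K. x j) \<partial>(\<Pi>\<^sub>M j\<in>insert i K. centered_normal 1))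
      = (\<integral>\<^sup>+x. \<integral>\<^sup>+y. f (\<Sum>j\<in>insert i K. (x(i := y)) j) \<partial>centered_normal 1 \<partial>(\<Pi>\<^sub>M j\<in>K. centered_normal 1))"
    using insert.hyps by (intro product_nn_integral_insert) auto
  also have "\<dots> = (\<integral>\<^sup>+x. \<integral>\<^sup>+y. f ((\<Sum>j\<in>K. x j) + y) \<partial>centered_normal 1 \<partial>(\<Pi>\<^sub>M j\<in>K. centered_normal 1))"
  proof -
    have "(\<Sum>j\<in>insert i K. (x(i := y)) j) = (\<Sum>j\<in>K. x j) + y" for x :: "'a \<Rightarrow> real" and y
      using insert.hyps by (auto intro!: sum.cong)
    then show ?thesis by simp
  qed
  also have "\<dots> = (\<integral>\<^sup>+s. \<integral>\<^sup>+y. f (s + y) \<partial>centered_normal 1 \<partial>gauss (card K))"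
    by (rule insert.IH) measurable
  also have "\<dots> = (\<integral>\<^sup>+s. f s \<partial>gauss (card (insert i K)))"
    using nn_integral_gauss_add[of f "real (card K)" 1] insert.hyps by (simp add: add.commute)
  finally show ?case .
qed

text \<open>Fubini separates the block \<open>K\<close> and replaces it by its sum. The other
  coordinates stay a vector, so that further blocks can be split off.\<close>

lemma nn_integral_PiM_gauss_split:
  assumes "finite I" "K \<subseteq> I" and g[measurable]: "g \<in> borel_measurable (borel \<Otimes>\<^sub>M (\<Pi>\<^sub>M j\<in>I - K. borel))"
  shows "(\<integral>\<^sup>+x. g (\<Sum>j\<in>K. x j, restrict x (I - K)) \<partial>(\<Pi>\<^sub>M j\<in>I. centered_normal 1))
    = (\<integral>\<^sup>+s. \<integral>\<^sup>+y. g (s, y) \<partial>(\<Pi>\<^sub>M j\<in>I - K. centered_normal 1) \<partial>gauss (card K))"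
proof -
  interpret product_sigma_finite "\<lambda>_. centered_normal 1" by (rule product_sigma_finite_centered_normal)
  interpret R: prob_space "\<Pi>\<^sub>M j\<in>I - K. centered_normal 1"
    by (intro prob_space_PiM) (simp add: prob_space_centered_normal)
  have fin: "finite K" "finite (I - K)" using assms finite_subset by auto
  have I: "K \<union> (I - K) = I" using assms by auto
  \<comment> \<open>\<open>centered_normal 1\<close> and \<open>borel\<close> have the same
    measurable sets, so the measurability of \<open>g\<close> carries over.\<close>
  have gm[measurable]: "g \<in> borel_measurable (borel \<Otimes>\<^sub>M (\<Pi>\<^sub>M j\<in>I - K. centered_normal 1))"
    by (subst measurable_cong_sets[OF sets_pair_measure_cong[OF refl sets_PiM_cong[OF refl, of "I - K" _ "\<lambda>_. borel"]] refl]) auto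
  have KI: "x \<in> K \<Longrightarrow> x \<in> I" for x using assms by auto
  have "(\<lambda>x. g (\<Sum>j\<in>K. x j, restrict x (I - K))) \<in> borel_measurable (\<Pi>\<^sub>M j\<in>I. centered_normal 1)"
    using KI by measurable
  then have "(\<integral>\<^sup>+x. g (\<Sum>j\<in>K. x j, restrict x (I - K)) \<partial>(\<Pi>\<^sub>M j\<in>I. centered_normal 1))
    = (\<integral>\<^sup>+x. \<integral>\<^sup>+y. g (\<Sum>j\<in>K. merge K (I - K) (x, y) j, restrict (merge K (I - K) (x, y)) (I - K))
        \<partial>(\<Pi>\<^sub>M j\<in>I - K. centered_normal 1) \<partial>(\<Pi>\<^sub>M j\<in>K. centered_normal 1))"
    using product_nn_integral_fold[of K "I - K" "\<lambda>x. g (\<Sum>j\<in>K. x j, restrict x (I - K))"] fin I by simp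
  also have "\<dots> = (\<integral>\<^sup>+x. \<integral>\<^sup>+y. g (\<Sum>j\<in>K. x j, y)
        \<partial>(\<Pi>\<^sub>M j\<in>I - K. centered_normal 1) \<partial>(\<Pi>\<^sub>M j\<in>K. centered_normal 1))"
  proof (intro nn_integral_cong)
    fix x y :: "'a \<Rightarrow> real" assume "y \<in> space (\<Pi>\<^sub>M j\<in>I - K. centered_normal 1)"
    then have "restrict (merge K (I - K) (x, y)) (I - K) = y"
      by (auto simp: space_PiM PiE_def extensional_def restrict_def merge_def)
    moreover have "(\<Sum>j\<in>K. merge K (I - K) (x, y) j) = (\<Sum>j\<in>K. x j)"
      by (rule sum.cong) (auto simp: merge_def)
    ultimately show "g (\<Sum>j\<in>K. merge K (I - K) (x, y) j, restrict (merge K (I - K) (x, y)) (I - K)) = g (\<Sum>j\<in>K. x j, y)"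
      by simp
  qed
  also have "\<dots> = (\<integral>\<^sup>+s. \<integral>\<^sup>+y. g (s, y) \<partial>(\<Pi>\<^sub>M j\<in>I - K. centered_normal 1) \<partial>gauss (card K))"
    by (rule nn_integral_PiM_gauss_sum) (use fin in auto)
  finally show ?thesis .
qed

lemma nn_integral_PiM_gauss_sum_subset:
  assumes "finite I" "K \<subseteq> I" and [measurable]: "f \<in> borel_measurable borel"
  shows "(\<integral>\<^sup>+x. f (\<Sum>j\<in>K. x j) \<partial>(\<Pi>\<^sub>M j\<in>I. centered_normal 1)) = (\<integral>\<^sup>+s. f s \<partial>gauss (card K))"
proof -
  interpret R: prob_space "\<Pi>\<^sub>M j\<in>I - K. centered_normal 1"
    by (intro prob_space_PiM) (simp add: prob_space_centered_normal)
  have "(\<integral>\<^sup>+x. f (\<Sum>j\<in>K. x j) \<partial>(\<Pi>\<^sub>M j\<in>I. centered_normal 1)) =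
     (\<integral>\<^sup>+s. \<integral>\<^sup>+y. f s \<partial>(\<Pi>\<^sub>M j\<in>I - K. centered_normal 1) \<partial>gauss (card K))"
    using nn_integral_PiM_gauss_split[OF assms(1,2), of "\<lambda>p. f (fst p)"] by simp
  then show ?thesis using R.emeasure_space_1 by simp
qed

text \<open>Splits off \<open>A\<close>, then \<open>B\<close>, then sums over \<open>C\<close>;
  coordinates outside the blocks integrate to one. It serves the common ones of two classifiers and
  the ones belonging to only one of them.\<close>

lemma nn_integral_PiM_gauss_sum3:
  assumes I: "finite I" "A \<subseteq> I" "B \<subseteq> I" "C \<subseteq> I"
    and disj: "A \<inter> B = {}" "A \<inter> C = {}" "B \<inter> C = {}"
    and f[measurable]: "f \<in> borel_measurable (borel \<Otimes>\<^sub>M borel \<Otimes>\<^sub>M borel)"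
  shows "(\<integral>\<^sup>+x. f (\<Sum>j\<in>A. x j, \<Sum>j\<in>B. x j, \<Sum>j\<in>C. x j) \<partial>(\<Pi>\<^sub>M j\<in>I. centered_normal 1))
    = (\<integral>\<^sup>+a. \<integral>\<^sup>+b. \<integral>\<^sup>+c. f (a, b, c) \<partial>gauss (card C) \<partial>gauss (card B) \<partial>gauss (card A))"
proof -
  have sub: "B \<subseteq> I - A" "C \<subseteq> I - A" "C \<subseteq> I - A - B" using assms by auto
  have m: "j \<in> B \<Longrightarrow> j \<in> I - A" "j \<in> C \<Longrightarrow> j \<in> I - A" "j \<in> C \<Longrightarrow> j \<in> I - A - B" for j using sub by auto
  have restr: "(\<Sum>j\<in>K. restrict x J j) = (\<Sum>j\<in>K. x j)" if "K \<subseteq> J" for K J and x :: "'a \<Rightarrow> real"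
    using that by (intro sum.cong) auto
  have "(\<lambda>p. f (fst p, \<Sum>j\<in>B. snd p j, \<Sum>j\<in>C. snd p j)) \<in> borel_measurable (borel \<Otimes>\<^sub>M (\<Pi>\<^sub>M j\<in>I - A. borel))"
    using m by measurable
  from nn_integral_PiM_gauss_split[OF I(1,2) this]
  have "(\<integral>\<^sup>+x. f (\<Sum>j\<in>A. x j, \<Sum>j\<in>B. x j, \<Sum>j\<in>C. x j) \<partial>(\<Pi>\<^sub>M j\<in>I. centered_normal 1))
    = (\<integral>\<^sup>+a. \<integral>\<^sup>+y. f (a, \<Sum>j\<in>B. y j, \<Sum>j\<in>C. y j) \<partial>(\<Pi>\<^sub>M j\<in>I - A. centered_normal 1) \<partial>gauss (card A))"
    by (simp only: restr[OF sub(1)] restr[OF sub(2)] fst_conv snd_conv)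
  also have "\<dots> = (\<integral>\<^sup>+a. \<integral>\<^sup>+b. \<integral>\<^sup>+c. f (a, b, c) \<partial>gauss (card C) \<partial>gauss (card B) \<partial>gauss (card A))"
  proof (rule nn_integral_cong)
    fix a :: real
    have "(\<lambda>p. f (a, fst p, \<Sum>j\<in>C. snd p j)) \<in> borel_measurable (borel \<Otimes>\<^sub>M (\<Pi>\<^sub>M j\<in>I - A - B. borel))"
      using m by measurable
    from nn_integral_PiM_gauss_split[OF _ sub(1) this]
    have "(\<integral>\<^sup>+y. f (a, \<Sum>j\<in>B. y j, \<Sum>j\<in>C. y j) \<partial>(\<Pi>\<^sub>M j\<in>I - A. centered_normal 1))
      = (\<integral>\<^sup>+b. \<integral>\<^sup>+y. f (a, b, \<Sum>j\<in>C. y j) \<partial>(\<Pi>\<^sub>M j\<in>I - A - B. centered_normal 1) \<partial>gauss (card B))"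
      using I by (simp only: restr[OF sub(3)] fst_conv snd_conv finite_Diff)
    also have "\<dots> = (\<integral>\<^sup>+b. \<integral>\<^sup>+c. f (a, b, c) \<partial>gauss (card C) \<partial>gauss (card B))"
      using I sub(3) by (intro nn_integral_cong nn_integral_PiM_gauss_sum_subset[of "I - A - B" C "\<lambda>c. f (a, b, c)" for b]) auto
    finally show "(\<integral>\<^sup>+y. f (a, \<Sum>j\<in>B. y j, \<Sum>j\<in>C. y j) \<partial>(\<Pi>\<^sub>M j\<in>I - A. centered_normal 1))
      = (\<integral>\<^sup>+b. \<integral>\<^sup>+c. f (a, b, c) \<partial>gauss (card C) \<partial>gauss (card B))" .
  qed
  finally show ?thesis .
qed

section \<open>The mean score of a competitor\<close>

abbreviation support :: "nat \<Rightarrow> (nat \<Rightarrow> real) \<Rightarrow> nat set" where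
  "support p w \<equiv> {j \<in> {..<p}. w j \<noteq> 0}"

lemma dot_binary:
  assumes "w \<in> binary_vectors p"
  shows "dot p x w = (\<Sum>j\<in>support p w. x j)"
proof -
  have "dot p x w = (\<Sum>j<p. if w j \<noteq> 0 then x j else 0)"
    unfolding dot_def
  proof (rule sum.cong)
    fix j assume "j \<in> {..<p}"
    with assms have "w j = 0 \<or> w j = 1" by (auto simp: binary_vectors_def)
    then show "x j * w j = (if w j \<noteq> 0 then x j else 0)" by auto
  qed simp
  also have "\<dots> = (\<Sum>j\<in>support p w. x j)" by (subst sum.inter_filter) auto
  finally show ?thesis .
qed

section \<open>The law of one observation and its error probabilities\<close>

lemma sets_std_gaussian [measurable_cong, simp]: "sets (std_gaussian p) = sets (\<Pi>\<^sub>M j\<in>{..<p}. borel)"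
  unfolding std_gaussian_def by (rule sets_PiM_cong) auto

lemma prob_space_std_gaussian: "prob_space (std_gaussian p)"
  unfolding std_gaussian_def by (intro prob_space_PiM) (simp add: prob_space_centered_normal)

lemma measurable_dot [measurable]: "(\<lambda>x. dot p x w) \<in> borel_measurable (\<Pi>\<^sub>M j\<in>{..<p}. borel)"
  unfolding dot_def by measurable

lemma measurable_classify [measurable]: "classify p w \<in> borel_measurable (\<Pi>\<^sub>M j\<in>{..<p}. borel)"
  unfolding classify_def[abs_def] by measurable

lemma measurable_noisy_label [measurable]:
  "(\<lambda>(x, e). noisy_label p w x e) \<in> borel_measurable ((\<Pi>\<^sub>M j\<in>{..<p}. borel) \<Otimes>\<^sub>M borel)"
  unfolding noisy_label_def[abs_def] by measurable

definition sample_law :: "nat \<Rightarrow> real \<Rightarrow> ((nat \<Rightarrow> real) \<times> real) measure" where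
  "sample_law p \<sigma> = std_gaussian p \<Otimes>\<^sub>M centered_normal \<sigma>"

lemma sets_sample_law [measurable_cong, simp]:
  "sets (sample_law p \<sigma>) = sets ((\<Pi>\<^sub>M j\<in>{..<p}. borel) \<Otimes>\<^sub>M borel)"
  unfolding sample_law_def by (rule sets_pair_measure_cong) auto

lemma prob_space_sample_law: "\<sigma> \<ge> 0 \<Longrightarrow> prob_space (sample_law p \<sigma>)"
  unfolding sample_law_def
  by (rule prob_space_pair) (simp_all add: prob_space_std_gaussian prob_space_centered_normal)

lemma nn_integral_sample_law:
  assumes "\<sigma> \<ge> 0" and f: "f \<in> borel_measurable ((\<Pi>\<^sub>M j\<in>{..<p}. borel) \<Otimes>\<^sub>M borel)"
  shows "(\<integral>\<^sup>+z. f z \<partial>sample_law p \<sigma>) = (\<integral>\<^sup>+x. \<integral>\<^sup>+e. f (x, e) \<partial>gauss (\<sigma>\<^sup>2) \<partial>(\<Pi>\<^sub>M j\<in>{..<p}. centered_normal 1))"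
proof -
  interpret N: prob_space "centered_normal \<sigma>" using assms by (simp add: prob_space_centered_normal)
  have "f \<in> borel_measurable (std_gaussian p \<Otimes>\<^sub>M centered_normal \<sigma>)"
    using f by (subst measurable_cong_sets[OF sets_pair_measure_cong refl]) auto
  then show ?thesis
    using N.nn_integral_fst[of f "std_gaussian p"] assms by (simp add: sample_law_def std_gaussian_def)
qed

lemma measurable_mismatch [measurable]:
  "(\<lambda>(x, e). of_bool (classify p v x \<noteq> noisy_label p w x e) :: ennreal)
    \<in> borel_measurable ((\<Pi>\<^sub>M j\<in>{..<p}. borel) \<Otimes>\<^sub>M borel)"
  by measurable

text \<open>The score of the true classifier has variance \<open>k\<close> and the label adds
  independent noise: a wedge with \<open>c = 1\<close>.\<close>

lemma nn_error_optimal: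
  assumes "\<sigma> \<ge> 0" "w \<in> binary_vectors p" "l0_norm p w = k" "k \<ge> 1"
  shows "(\<integral>\<^sup>+(x, e). of_bool (classify p w x \<noteq> noisy_label p w x e) \<partial>sample_law p \<sigma>)
    = ennreal (arccos (sqrt k / sqrt (k + \<sigma>\<^sup>2)) / pi)"
proof -
  interpret N: prob_space "gauss (\<sigma>\<^sup>2)" by (simp add: prob_space_centered_normal)
  have "(\<integral>\<^sup>+(x, e). of_bool (classify p w x \<noteq> noisy_label p w x e) \<partial>sample_law p \<sigma>)
     = (\<integral>\<^sup>+x. (\<integral>\<^sup>+e. of_bool (bsign (\<Sum>j\<in>support p w. x j) \<noteq> bsign ((\<Sum>j\<in>support p w. x j) + e)) \<partial>gauss (\<sigma>\<^sup>2)) \<partial>(\<Pi>\<^sub>M j\<in>{..<p}. centered_normal 1))"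
    using assms by (subst nn_integral_sample_law[OF _ measurable_mismatch]) (auto simp: classify_def noisy_label_def dot_binary simp del: real_sqrt_abs)
  also have "\<dots> = (\<integral>\<^sup>+s. (\<integral>\<^sup>+e. of_bool (bsign s \<noteq> bsign (s + e)) \<partial>gauss (\<sigma>\<^sup>2)) \<partial>gauss (card (support p w)))"
    by (rule nn_integral_PiM_gauss_sum_subset) (auto simp del: real_sqrt_abs)
  also have "\<dots> = (\<integral>\<^sup>+s. (\<integral>\<^sup>+e. of_bool (bsign s \<noteq> bsign (1 * s + e)) \<partial>gauss (\<sigma>\<^sup>2)) \<partial>gauss k)"
    using assms by (simp add: l0_norm_def)
  also have "\<dots> = ennreal (arccos (1 * sqrt k / sqrt ((1::real)\<^sup>2 * k + \<sigma>\<^sup>2)) / pi)"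
    using assms by (intro wedge_probability) auto
  finally show ?thesis by simp
qed

text \<open>Over the common, extra and missed ones \<open>C\<close>, \<open>V\<close>,
  \<open>U\<close> the coordinate sums \<open>s\<close>, \<open>v\<close>, \<open>u\<close> are
  independent with variances \<open>k - d\<close>, \<open>d\<close>, \<open>d\<close>. The
  competitor sees \<open>s + v\<close> and the label \<open>s + u + e\<close>, so
  \<open>mismatch_probability\<close> applies once the noise is merged into
  \<open>u\<close>.\<close>

lemma nn_error_competitor:
  assumes "\<sigma> \<ge> 0" "w \<in> binary_vectors p" "v \<in> binary_vectors p" "l0_norm p w = k" "l0_norm p v = k"
    and d: "d = card (support p w - support p v)" "d \<ge> 1"
  shows "(\<integral>\<^sup>+(x, e). of_bool (classify p v x \<noteq> noisy_label p w x e) \<partial>sample_law p \<sigma>)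
    = ennreal (arccos ((real k - real d) / (sqrt k * sqrt (k + \<sigma>\<^sup>2))) / pi)"
proof -
  interpret N: prob_space "gauss (\<sigma>\<^sup>2)" by (simp add: prob_space_centered_normal)
  define C U V where "C = support p w \<inter> support p v" and "U = support p w - support p v" and "V = support p v - support p w"
  have split: "support p w = C \<union> U" "support p v = C \<union> V" "C \<inter> U = {}" "C \<inter> V = {}" "V \<inter> U = {}"
    by (auto simp: C_def U_def V_def)
  have fin: "finite C" "finite U" "finite V" by (auto simp: C_def U_def V_def)
  have cards: "card C + card U = k" "card C + card V = k" "card U = d"
    using assms(4,5) d(1) card_Un_disjoint[of C U] card_Un_disjoint[of C V] split fin
    unfolding l0_norm_def U_def[symmetric] by metis+
  then have cV: "card V = d" by simp
  define f :: "real \<times> real \<times> real \<Rightarrow> ennreal" where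
    "f z = (case z of (s, v, u) \<Rightarrow> \<integral>\<^sup>+e. of_bool (bsign (s + v) \<noteq> bsign (s + u + e)) \<partial>gauss (\<sigma>\<^sup>2))" for z
  have [measurable]: "f \<in> borel_measurable (borel \<Otimes>\<^sub>M borel \<Otimes>\<^sub>M borel)" unfolding f_def by measurable
  have dots: "dot p x w = (\<Sum>j\<in>C. x j) + (\<Sum>j\<in>U. x j)" "dot p x v = (\<Sum>j\<in>C. x j) + (\<Sum>j\<in>V. x j)" for x
    using assms split fin by (simp_all add: dot_binary sum.union_disjoint)
  have "(\<integral>\<^sup>+(x, e). of_bool (classify p v x \<noteq> noisy_label p w x e) \<partial>sample_law p \<sigma>)
     = (\<integral>\<^sup>+x. f (\<Sum>j\<in>C. x j, \<Sum>j\<in>V. x j, \<Sum>j\<in>U. x j) \<partial>(\<Pi>\<^sub>M j\<in>{..<p}. centered_normal 1))"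
    using assms(1) by (subst nn_integral_sample_law[OF _ measurable_mismatch]) (auto simp: f_def classify_def noisy_label_def dots simp del: real_sqrt_abs)
  also have "\<dots> = (\<integral>\<^sup>+s. \<integral>\<^sup>+v. \<integral>\<^sup>+u. f (s, v, u) \<partial>gauss (card U) \<partial>gauss (card V) \<partial>gauss (card C))"
    by (rule nn_integral_PiM_gauss_sum3) (use split in \<open>auto simp: C_def U_def V_def\<close>)
  also have "\<dots> = (\<integral>\<^sup>+s. \<integral>\<^sup>+v. \<integral>\<^sup>+u. of_bool (bsign (s + v) \<noteq> bsign (s + u)) \<partial>gauss (d + \<sigma>\<^sup>2) \<partial>gauss d \<partial>gauss (card C))"
    unfolding cV cards(3)
  proof (intro nn_integral_cong)
    fix s v :: real
    show "(\<integral>\<^sup>+u. f (s, v, u) \<partial>gauss d) = (\<integral>\<^sup>+u. of_bool (bsign (s + v) \<noteq> bsign (s + u)) \<partial>gauss (d + \<sigma>\<^sup>2))"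
      using nn_integral_gauss_add[of "\<lambda>u. of_bool (bsign (s + v) \<noteq> bsign (s + u))" "real d" "\<sigma>\<^sup>2"]
      by (simp add: f_def add.assoc del: real_sqrt_abs)
  qed
  also have "\<dots> = ennreal (arccos (card C / (sqrt (real (card C) + d) * sqrt (card C + (d + \<sigma>\<^sup>2)))) / pi)"
    using d by (intro mismatch_probability) (auto simp: add_pos_nonneg)
  also have "real (card C) = real k - real d" using cards by linarith
  finally show ?thesis using cards by simp
qed

definition score :: "nat \<Rightarrow> (nat \<Rightarrow> real) \<Rightarrow> (nat \<Rightarrow> real) \<Rightarrow> (nat \<Rightarrow> real) \<times> real \<Rightarrow> real" where
  "score p w v z = of_bool (classify p v (fst z) \<noteq> noisy_label p w (fst z) (snd z))
    - of_bool (classify p w (fst z) \<noteq> noisy_label p w (fst z) (snd z))"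

lemma measurable_score [measurable]: "score p w v \<in> borel_measurable ((\<Pi>\<^sub>M j\<in>{..<p}. borel) \<Otimes>\<^sub>M borel)"
  unfolding score_def by measurable

lemma score_bounds: "score p w v z \<in> {-1..1}"
  by (auto simp: score_def)

text \<open>The mean is a difference of two angles divided by \<open>pi\<close>, estimated by
  \<open>angle_gap\<close>.\<close>

lemma score_mean:
  assumes "\<sigma> \<ge> 0" "w \<in> binary_vectors p" "v \<in> binary_vectors p" "l0_norm p w = k" "l0_norm p v = k"
    and d: "d = card (support p w - support p v)" "d \<ge> 1"
  shows "(\<integral>z. score p w v z \<partial>sample_law p \<sigma>) \<ge> sqrt (d / (k * (\<sigma>\<^sup>2 + 2))) / pi"
proof -
  interpret P: prob_space "sample_law p \<sigma>" using assms by (simp add: prob_space_sample_law)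
  define err :: "(nat \<Rightarrow> real) \<Rightarrow> (nat \<Rightarrow> real) \<times> real \<Rightarrow> real"
    where "err u z = of_bool (classify p u (fst z) \<noteq> noisy_label p w (fst z) (snd z))" for u z
  have [measurable]: "err u \<in> borel_measurable ((\<Pi>\<^sub>M j\<in>{..<p}. borel) \<Otimes>\<^sub>M borel)" for u
    unfolding err_def by measurable
  have int: "integrable (sample_law p \<sigma>) (err u)" for u
    by (rule P.integrable_const_bound[where B = 1]) (auto simp: err_def)
  have err: "(\<integral>z. err u z \<partial>sample_law p \<sigma>) = enn2real (\<integral>\<^sup>+(x, e). of_bool (classify p u x \<noteq> noisy_label p w x e) \<partial>sample_law p \<sigma>)" for u
    by (subst integral_eq_nn_integral)
      (auto simp: err_def split_beta intro!: arg_cong[where f = enn2real] nn_integral_cong)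
  have "d \<le> k" using assms card_mono[of "support p w" "support p w - support p v"] by (simp add: l0_norm_def)
  then have k1: "k \<ge> 1" using d by simp
  \<comment> \<open>\<open>ennreal\<close> truncates negative numbers, so both angles must be known
    to be nonnegative before returning to real values.\<close>
  have nn: "0 \<le> arccos (sqrt k / sqrt (k + \<sigma>\<^sup>2))"
  proof (rule arccos_lbound)
    have "real k + \<sigma>\<^sup>2 > 0" using k1 by (simp add: add_pos_nonneg)
    then show "- 1 \<le> sqrt k / sqrt (k + \<sigma>\<^sup>2)" "sqrt k / sqrt (k + \<sigma>\<^sup>2) \<le> 1"
      by (auto intro: order_trans[of _ 0])
  qed
  have gap: "sqrt (d / (k * (\<sigma>\<^sup>2 + 2))) \<le> arccos ((real k - real d) / (sqrt k * sqrt (k + \<sigma>\<^sup>2))) - arccos (sqrt k / sqrt (k + \<sigma>\<^sup>2))"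
    using angle_gap[of d k "\<sigma>\<^sup>2"] d \<open>d \<le> k\<close> by simp
  then have nn2: "0 \<le> arccos ((real k - real d) / (sqrt k * sqrt (k + \<sigma>\<^sup>2)))"
    using nn by (smt (verit) real_sqrt_ge_zero divide_nonneg_nonneg mult_nonneg_nonneg of_nat_0_le_iff zero_le_power2)
  have "(\<integral>z. score p w v z \<partial>sample_law p \<sigma>) = (\<integral>z. err v z \<partial>sample_law p \<sigma>) - (\<integral>z. err w z \<partial>sample_law p \<sigma>)"
    unfolding Bochner_Integration.integral_diff[OF int int, symmetric] by (simp add: score_def err_def)
  also have "\<dots> = arccos ((real k - real d) / (sqrt k * sqrt (k + \<sigma>\<^sup>2))) / pi - arccos (sqrt k / sqrt (k + \<sigma>\<^sup>2)) / pi"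
    using nn nn2 unfolding err nn_error_competitor[OF assms] nn_error_optimal[OF assms(1,2,4) k1] by simp
  also have "\<dots> \<ge> sqrt (d / (k * (\<sigma>\<^sup>2 + 2))) / pi"
    using gap by (simp flip: diff_divide_distrib add: divide_right_mono)
  finally show ?thesis .
qed

section \<open>Independence of the observations\<close>

text \<open>Preimages commute with intersections. Grouping independent families into generated
  \<sigma>-algebras requires such intersection-stable generators.\<close>

lemma Int_stable_vimage: "Int_stable {f -` A \<inter> \<Omega> | A. A \<in> sets N}"
proof (rule Int_stableI)
  fix a b assume "a \<in> {f -` A \<inter> \<Omega> | A. A \<in> sets N}" "b \<in> {f -` A \<inter> \<Omega> | A. A \<in> sets N}"
  then obtain A B where "A \<in> sets N" "B \<in> sets N" "a = f -` A \<inter> \<Omega>" "b = f -` B \<inter> \<Omega>" by blast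
  then have "a \<inter> b = f -` (A \<inter> B) \<inter> \<Omega>" "A \<inter> B \<in> sets N" by auto
  then show "a \<inter> b \<in> {f -` A \<inter> \<Omega> | A. A \<in> sets N}" by blast
qed

context gaussian_sample
begin

definition observation :: "nat \<Rightarrow> 'a \<Rightarrow> (nat \<Rightarrow> real) \<times> real" where
  "observation i \<omega> = (X i \<omega>, E i \<omega>)"

lemma measurable_X: "i < n \<Longrightarrow> X i \<in> M \<rightarrow>\<^sub>M (\<Pi>\<^sub>M j\<in>{..<p}. borel)"
  using X_indep by (auto simp: indep_vars_def)

lemma measurable_E: "i < n \<Longrightarrow> E i \<in> M \<rightarrow>\<^sub>M borel"
  using E_indep by (auto simp: indep_vars_def)

lemma measurable_observation: "i < n \<Longrightarrow> observation i \<in> M \<rightarrow>\<^sub>M (\<Pi>\<^sub>M j\<in>{..<p}. borel) \<Otimes>\<^sub>M borel"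
  unfolding observation_def[abs_def] by (intro measurable_Pair measurable_X measurable_E)

definition design_events :: "nat \<Rightarrow> 'a set set" where
  "design_events i = {X i -` A \<inter> space M | A. A \<in> sets (\<Pi>\<^sub>M j\<in>{..<p}. borel)}"

definition noise_events :: "nat \<Rightarrow> 'a set set" where
  "noise_events i = {E i -` A \<inter> space M | A. A \<in> sets borel}"

abbreviation design_algebra :: "'a measure" where
  "design_algebra \<equiv> vimage_algebra (space M) (\<lambda>\<omega>. \<lambda>i\<in>{..<n}. X i \<omega>) (\<Pi>\<^sub>M i\<in>{..<n}. \<Pi>\<^sub>M j\<in>{..<p}. borel)"

abbreviation noise_algebra :: "'a measure" where
  "noise_algebra \<equiv> vimage_algebra (space M) (\<lambda>\<omega>. \<lambda>i\<in>{..<n}. E i \<omega>) (\<Pi>\<^sub>M i\<in>{..<n}. borel)"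

lemma design_events_subset:
  assumes "i < n" shows "design_events i \<subseteq> sets design_algebra"
proof -
  have "(\<lambda>\<omega>. \<lambda>i\<in>{..<n}. X i \<omega>) \<in> design_algebra \<rightarrow>\<^sub>M (\<Pi>\<^sub>M i\<in>{..<n}. \<Pi>\<^sub>M j\<in>{..<p}. borel)"
    using measurable_space[OF measurable_X] by (intro measurable_vimage_algebra1) (auto simp: space_PiM)
  from measurable_compose[OF this measurable_component_singleton[of i]]
  have "X i \<in> design_algebra \<rightarrow>\<^sub>M (\<Pi>\<^sub>M j\<in>{..<p}. borel)" using assms by simp
  from measurable_sets[OF this] show ?thesis by (auto simp: design_events_def)
qed

lemma noise_events_subset:
  assumes "i < n" shows "noise_events i \<subseteq> sets noise_algebra"
proof -
  have "(\<lambda>\<omega>. \<lambda>i\<in>{..<n}. E i \<omega>) \<in> noise_algebra \<rightarrow>\<^sub>M (\<Pi>\<^sub>M i\<in>{..<n}. borel)"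
    by (intro measurable_vimage_algebra1) (auto simp: space_PiM)
  from measurable_compose[OF this measurable_component_singleton[of i]]
  have "E i \<in> noise_algebra \<rightarrow>\<^sub>M borel" using assms by simp
  from measurable_sets[OF this] show ?thesis by (auto simp: noise_events_def)
qed

text \<open>An intersection of events splits by the Boolean tag into a design part and a noise part.
  \<open>X_E_indep\<close> factors the two parts, and independence within each family factors the
  rest.\<close>

lemma indep_coordinates:
  "indep_sets (\<lambda>(b, i). if b then design_events i else noise_events i) (UNIV \<times> {..<n})"
proof (rule indep_setsI)
  show "(case l of (b, i) \<Rightarrow> if b then design_events i else noise_events i) \<subseteq> events"
    if "l \<in> UNIV \<times> {..<n}" for l :: "bool \<times> nat"
    using that measurable_sets[OF measurable_X] measurable_sets[OF measurable_E]
    by (cases "fst l"; cases l) (auto simp: design_events_def noise_events_def)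
next
  fix A :: "bool \<times> nat \<Rightarrow> 'a set" and L :: "(bool \<times> nat) set"
  assume L: "L \<noteq> {}" "L \<subseteq> UNIV \<times> {..<n}" "finite L"
    and A: "\<forall>l\<in>L. A l \<in> (case l of (b, i) \<Rightarrow> if b then design_events i else noise_events i)"
  define J K where "J = {i. (True, i) \<in> L}" and "K = {i. (False, i) \<in> L}"
  have L_eq: "L = Pair True ` J \<union> Pair False ` K"
  proof -
    have "(b, i) \<in> L \<longleftrightarrow> (b, i) \<in> Pair True ` J \<union> Pair False ` K" for b i
      by (cases b) (auto simp: J_def K_def)
    then show ?thesis by auto
  qed
  have fin: "finite J" "finite K" using L(3) unfolding L_eq by (auto dest: finite_imageD simp: inj_on_def)
  have sub: "J \<subseteq> {..<n}" "K \<subseteq> {..<n}" using L(2) by (auto simp: J_def K_def)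
  have AJ: "A (True, i) \<in> design_events i" if "i \<in> J" for i using A that by (force simp: J_def)
  have AK: "A (False, i) \<in> noise_events i" if "i \<in> K" for i using A that by (force simp: K_def)
  \<comment> \<open>Intersecting with \<open>space M\<close> gives an empty index set the whole
    space instead of \<open>UNIV\<close>.\<close>
  define a b where "a = (\<Inter>i\<in>J. A (True, i)) \<inter> space M" and "b = (\<Inter>i\<in>K. A (False, i)) \<inter> space M"
  have spJ: "A (True, i) \<subseteq> space M" if "i \<in> J" for i using AJ[OF that] by (auto simp: design_events_def)
  have spK: "A (False, i) \<subseteq> space M" if "i \<in> K" for i using AK[OF that] by (auto simp: noise_events_def)
  have pa: "prob a = (\<Prod>i\<in>J. prob (A (True, i)))"
  proof (cases "J = {}")
    case False
    then have "a = (\<Inter>i\<in>J. A (True, i))" using spJ by (auto simp: a_def)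
    moreover have "indep_sets design_events {..<n}"
      using X_indep by (simp add: indep_vars_def2 design_events_def[abs_def])
    ultimately show ?thesis using False fin sub AJ by (simp add: indep_setsD)
  qed (simp add: a_def prob_space)
  have pb: "prob b = (\<Prod>i\<in>K. prob (A (False, i)))"
  proof (cases "K = {}")
    case False
    then have "b = (\<Inter>i\<in>K. A (False, i))" using spK by (auto simp: b_def)
    moreover have "indep_sets noise_events {..<n}"
      using E_indep by (simp add: indep_vars_def2 noise_events_def[abs_def])
    ultimately show ?thesis using False fin sub AK by (simp add: indep_setsD)
  qed (simp add: b_def prob_space)
  have "a = (if J = {} then space design_algebra else (\<Inter>i\<in>J. A (True, i)))" using spJ by (auto simp: a_def)
  also have "\<dots> \<in> sets design_algebra"
  proof (cases "J = {}")
    case False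
    have "A (True, i) \<in> sets design_algebra" if "i \<in> J" for i
      using design_events_subset AJ sub that by blast
    with False fin show ?thesis by (simp add: sets.finite_INT)
  qed (simp del: space_vimage_algebra)
  finally have sa: "a \<in> sets design_algebra" .
  have "b = (if K = {} then space noise_algebra else (\<Inter>i\<in>K. A (False, i)))" using spK by (auto simp: b_def)
  also have "\<dots> \<in> sets noise_algebra"
  proof (cases "K = {}")
    case False
    have "A (False, i) \<in> sets noise_algebra" if "i \<in> K" for i
      using noise_events_subset AK sub that by blast
    with False fin show ?thesis by (simp add: sets.finite_INT)
  qed (simp del: space_vimage_algebra)
  finally have sb: "b \<in> sets noise_algebra" .
  have "(\<Inter>l\<in>L. A l) = (\<Inter>i\<in>J. A (True, i)) \<inter> (\<Inter>i\<in>K. A (False, i))"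
    unfolding L_eq by auto
  moreover have "(\<Inter>l\<in>L. A l) \<subseteq> space M"
    using L(1) spJ spK unfolding L_eq by blast
  ultimately have "(\<Inter>l\<in>L. A l) = a \<inter> b"
    unfolding a_def b_def by blast
  then have "prob (\<Inter>l\<in>L. A l) = prob a * prob b"
    using indep_setD[OF X_E_indep sa sb] by simp
  also have "\<dots> = (\<Prod>l\<in>L. prob (A l))"
    unfolding pa pb L_eq using fin by (subst prod.union_disjoint) (auto simp: prod.reindex inj_on_def)
  finally show "prob (\<Inter>l\<in>L. A l) = (\<Prod>l\<in>L. prob (A l))" .
qed

text \<open>The design and noise events of one index form a block. Disjoint blocks generate
  independent \<sigma>-algebras, and \<open>observation i\<close> is measurable for the block of
  \<open>i\<close>.\<close>

lemma indep_observations: "indep_vars (\<lambda>_. (\<Pi>\<^sub>M j\<in>{..<p}. borel) \<Otimes>\<^sub>M borel) observation {..<n}"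
proof -
  let ?F = "\<lambda>(b, i). if b then design_events i else noise_events i"
  let ?G = "\<lambda>i. \<Union>l\<in>UNIV \<times> {i}. ?F l"
  have "indep_sets (\<lambda>i. sigma_sets (space M) (?G i)) {..<n}"
  proof (rule indep_sets_collect_sigma)
    show "indep_sets ?F (\<Union>i\<in>{..<n}. UNIV \<times> {i})"
      using indep_coordinates by (rule back_subst[where P = "indep_sets _"]) auto
    show "Int_stable (?F l)" for l
      by (cases l) (simp add: design_events_def noise_events_def Int_stable_vimage)
    show "disjoint_family_on (\<lambda>i. UNIV \<times> {i}) {..<n}" by (auto simp: disjoint_family_on_def)
  qed
  then have "indep_sets (\<lambda>i. {observation i -` A \<inter> space M | A. A \<in> sets ((\<Pi>\<^sub>M j\<in>{..<p}. borel) \<Otimes>\<^sub>M borel)}) {..<n}"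
  proof (rule indep_sets_mono_sets)
    fix i assume "i \<in> {..<n}"
    define S where "S = sigma (space M) (?G i)"
    have G: "?G i = design_events i \<union> noise_events i" by (auto simp: UNIV_bool)
    have sub: "?G i \<subseteq> Pow (space M)" unfolding G by (auto simp: design_events_def noise_events_def)
    have sp: "space S = space M" unfolding S_def by (rule space_measure_of[OF sub])
    have sets: "sets S = sigma_sets (space M) (?G i)" unfolding S_def by (rule sets_measure_of[OF sub])
    have "X i \<in> S \<rightarrow>\<^sub>M (\<Pi>\<^sub>M j\<in>{..<p}. borel)"
      by (rule measurableI) (use \<open>i \<in> {..<n}\<close> measurable_space[OF measurable_X] in
          \<open>auto simp: sp sets G design_events_def intro!: sigma_sets.Basic\<close>)
    moreover have "E i \<in> S \<rightarrow>\<^sub>M borel"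
      by (rule measurableI) (auto simp: sp sets G noise_events_def intro!: sigma_sets.Basic)
    ultimately have "observation i \<in> S \<rightarrow>\<^sub>M (\<Pi>\<^sub>M j\<in>{..<p}. borel) \<Otimes>\<^sub>M borel"
      unfolding observation_def[abs_def] by (rule measurable_Pair)
    then show "{observation i -` A \<inter> space M | A. A \<in> sets ((\<Pi>\<^sub>M j\<in>{..<p}. borel) \<Otimes>\<^sub>M borel)} \<subseteq> sigma_sets (space M) (?G i)"
      using measurable_sets[of "observation i" S] by (auto simp: sp sets)
  qed
  then show ?thesis using measurable_observation by (auto simp: indep_vars_def2)
qed

text \<open>Both marginals are \<sigma>-finite, so agreement on rectangles suffices; there
  \<open>X_E_indep\<close> factors the probability.\<close>

lemma distr_observation:
  assumes "i < n" "\<sigma> \<ge> 0"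
  shows "distr M ((\<Pi>\<^sub>M j\<in>{..<p}. borel) \<Otimes>\<^sub>M borel) (observation i) = sample_law p \<sigma>"
  unfolding sample_law_def
proof (rule pair_measure_eqI[symmetric])
  show "sigma_finite_measure (std_gaussian p)" "sigma_finite_measure (centered_normal \<sigma>)"
    using assms by (simp_all add: prob_space_imp_sigma_finite prob_space_std_gaussian prob_space_centered_normal)
  show "sets (std_gaussian p \<Otimes>\<^sub>M centered_normal \<sigma>) = sets (distr M ((\<Pi>\<^sub>M j\<in>{..<p}. borel) \<Otimes>\<^sub>M borel) (observation i))"
    using sets_sample_law[of p \<sigma>] by (simp add: sample_law_def)
  fix A B assume A: "A \<in> sets (std_gaussian p)" and B: "B \<in> sets (centered_normal \<sigma>)"
  have sA: "X i -` A \<inter> space M \<in> sets design_algebra" and sB: "E i -` B \<inter> space M \<in> sets noise_algebra"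
    using design_events_subset[OF assms(1)] noise_events_subset[OF assms(1)] A B
    by (auto simp: design_events_def noise_events_def)
  have "emeasure (std_gaussian p) A = ennreal (prob (X i -` A \<inter> space M))"
    using A assms measurable_X unfolding X_law[OF assms(1), symmetric]
    by (subst emeasure_distr) (auto simp: emeasure_eq_measure)
  moreover have "emeasure (centered_normal \<sigma>) B = ennreal (prob (E i -` B \<inter> space M))"
    using B assms measurable_E unfolding E_law[OF assms(1), symmetric]
    by (subst emeasure_distr) (auto simp: emeasure_eq_measure)
  moreover have "emeasure (distr M ((\<Pi>\<^sub>M j\<in>{..<p}. borel) \<Otimes>\<^sub>M borel) (observation i)) (A \<times> B)
      = ennreal (prob ((X i -` A \<inter> space M) \<inter> (E i -` B \<inter> space M)))"
  proof -
    have "observation i -` (A \<times> B) \<inter> space M = (X i -` A \<inter> space M) \<inter> (E i -` B \<inter> space M)"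
      by (auto simp: observation_def)
    then show ?thesis using A B assms measurable_observation by (subst emeasure_distr) (auto simp: emeasure_eq_measure)
  qed
  ultimately show "emeasure (std_gaussian p) A * emeasure (centered_normal \<sigma>) B
      = emeasure (distr M ((\<Pi>\<^sub>M j\<in>{..<p}. borel) \<Otimes>\<^sub>M borel) (observation i)) (A \<times> B)"
    using indep_setD[OF X_E_indep sA sB] by (simp add: ennreal_mult)
qed

text \<open>Hoeffding's inequality for independent variables in \<open>[-1, 1]\<close> with mean at
  least \<open>c\<close>: a sum below zero deviates from its expectation by at least
  \<open>n * c\<close>.\<close>

lemma score_concentration:
  fixes c :: real
  assumes "n > 0" "\<sigma> \<ge> 0" and c: "0 \<le> c" "c \<le> (\<integral>z. score p w v z \<partial>sample_law p \<sigma>)"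
  shows "prob {\<omega> \<in> space M. (\<Sum>i<n. score p w v (observation i \<omega>)) \<le> 0} \<le> exp (- (n * c\<^sup>2 / 2))"
proof -
  define m where "m = (\<integral>z. score p w v z \<partial>sample_law p \<sigma>)"
  have mean: "expectation (\<lambda>\<omega>. score p w v (observation i \<omega>)) = m" if "i < n" for i
    unfolding m_def distr_observation[OF that assms(2), symmetric]
    using measurable_observation[OF that] by (subst integral_distr) auto
  interpret H: Hoeffding_ineq M "{..<n}" "\<lambda>i \<omega>. score p w v (observation i \<omega>)" "\<lambda>_. -1" "\<lambda>_. 1" "n * m"
  proof unfold_locales
    show "indep_vars (\<lambda>_. borel) (\<lambda>i \<omega>. score p w v (observation i \<omega>)) {..<n}"
      by (rule indep_vars_compose2[OF indep_observations]) measurable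
    show "real n * m \<equiv> \<Sum>i\<in>{..<n}. expectation (\<lambda>\<omega>. score p w v (observation i \<omega>))"
      using mean by simp
  qed (use score_bounds in auto)
  \<comment> \<open>The bound zero is written as expectation minus deviation, with deviation
    \<open>n * m\<close>. The squared ranges sum to \<open>4 * n\<close>, which leaves the exponent
    \<open>n * m\<^sup>2 / 2\<close>.\<close>
  have "prob {\<omega> \<in> space M. (\<Sum>i<n. score p w v (observation i \<omega>)) \<le> n * m - n * m}
      \<le> exp (-2 * (n * m)\<^sup>2 / (\<Sum>i<n. (1 - (-1))\<^sup>2))"
    using assms by (intro H.Hoeffding_ineq_le) (auto simp: m_def)
  also have "-2 * (n * m)\<^sup>2 / (\<Sum>i<n. (1 - (-1))\<^sup>2) = - (n * m\<^sup>2 / 2)"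
    using assms(1) by (simp add: power2_eq_square divide_simps)
  also have "exp (- (n * m\<^sup>2 / 2)) \<le> exp (- (n * c\<^sup>2 / 2))"
    using c by (simp add: m_def mult_left_mono power_mono)
  finally show ?thesis by simp
qed

end

section \<open>Union bound over competitors\<close>

text \<open>Inside \<open>{..<p}\<close> the support determines a 0/1 value; outside, both functions
  are \<open>undefined\<close>.\<close>

lemma binary_vector_eqI:
  assumes "v \<in> binary_vectors p" "w \<in> binary_vectors p" "support p v = support p w"
  shows "v = w"
  using assms(1,2) unfolding binary_vectors_def
proof (rule PiE_ext)
  fix j assume j: "j \<in> {..<p}"
  then have "v j \<in> {0, 1}" "w j \<in> {0, 1}" using assms(1,2) by (auto simp: binary_vectors_def)
  moreover have "v j \<noteq> 0 \<longleftrightarrow> w j \<noteq> 0" using j assms(3) by blast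
  ultimately show "v j = w j" by auto
qed

definition competitors :: "nat \<Rightarrow> nat \<Rightarrow> (nat \<Rightarrow> real) \<Rightarrow> (nat \<Rightarrow> real) set" where
  "competitors p k w = {v \<in> binary_vectors p. v \<noteq> w \<and> l0_norm p v = k}"

lemma finite_competitors: "finite (competitors p k w)"
  by (rule finite_subset[of _ "binary_vectors p"]) (auto simp: competitors_def binary_vectors_def intro!: finite_PiE)

lemma binomial_le_power: "n choose r \<le> n ^ r"
  by (cases "r \<le> n") (auto simp: binomial_le_pow binomial_eq_0)

context
  fixes p k :: nat and w :: "nat \<Rightarrow> real"
  assumes w: "w \<in> binary_vectors p" "l0_norm p w = k"
begin

text \<open>Supports of equal size that are nested coincide, so a competitor misses at least one
  element.\<close>

lemma missed_bounds:
  assumes "v \<in> competitors p k w"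
  shows "card (support p w - support p v) \<in> {1..k}"
proof -
  have "\<not> support p w \<subseteq> support p v"
  proof
    assume "support p w \<subseteq> support p v"
    then have "support p w = support p v"
      using assms w by (intro card_subset_eq) (auto simp: competitors_def l0_norm_def)
    then show False using binary_vector_eqI[of v p w] assms w by (auto simp: competitors_def)
  qed
  then have "card (support p w - support p v) \<noteq> 0" by auto
  moreover have "card (support p w - support p v) \<le> k"
    using w(2) card_mono[of "support p w" "support p w - support p v"] by (simp add: l0_norm_def)
  ultimately show ?thesis unfolding atLeastAtMost_iff by linarith
qed

text \<open>A competitor is determined by the ones it misses and the ones it adds, and both sets
  have size \<open>d\<close>. The two binomial coefficients are at most \<open>(p - k) ^ d\<close>,
  the first because \<open>k \<le> p - k\<close>.\<close>

lemma card_competitors_missing: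
  assumes "p \<ge> 2 * k"
  shows "card {v \<in> competitors p k w. card (support p w - support p v) = d} \<le> ((p - k)\<^sup>2) ^ d"
proof -
  let ?W = "support p w"
  let ?S = "{v \<in> competitors p k w. card (?W - support p v) = d}"
  let ?T = "{A. A \<subseteq> ?W \<and> card A = d} \<times> {B. B \<subseteq> {..<p} - ?W \<and> card B = d}"
  define f where "f v = (?W - support p v, support p v - ?W)" for v
  have "inj_on f ?S"
  proof (rule inj_onI)
    fix v v' assume "v \<in> ?S" "v' \<in> ?S" "f v = f v'"
    have eq: "A = B" if "W - A = W - B" "A - W = B - W" for A B W :: "nat set" using that by blast
    have "support p v = support p v'"
      by (rule eq[of ?W]) (use \<open>f v = f v'\<close> in \<open>simp_all only: f_def prod.inject\<close>)
    then show "v = v'"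
      using \<open>v \<in> ?S\<close> \<open>v' \<in> ?S\<close> by (intro binary_vector_eqI[of v p]) (simp_all only: competitors_def mem_Collect_eq)
  qed
  moreover have "f ` ?S \<subseteq> ?T"
  proof
    fix z assume "z \<in> f ` ?S"
    then obtain v where v: "v \<in> ?S" "z = f v" by auto
    have "card (support p v) = card ?W"
      using v(1) w by (simp add: competitors_def l0_norm_def)
    then have "card (support p v - ?W) = card (?W - support p v)"
      using card_Int_Diff[of ?W "support p v"] card_Int_Diff[of "support p v" ?W] by (simp add: Int_commute)
    with v show "z \<in> ?T" by (auto simp: f_def)
  qed
  moreover have "finite ?T" by (intro finite_cartesian_product) (auto intro: finite_subset[of _ "Pow {..<p}"])
  ultimately have "card ?S \<le> card ?T" by (rule card_inj_on_le)
  also have "\<dots> = (k choose d) * ((p - k) choose d)"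
  proof -
    have "card ?W = k" using w by (simp add: l0_norm_def)
    moreover from this have "card ({..<p} - ?W) = p - k" by (subst card_Diff_subset) auto
    moreover have "finite ?W" "finite ({..<p} - ?W)" by auto
    ultimately show ?thesis by (simp only: card_cartesian_product n_subsets)
  qed
  also have "\<dots> \<le> (p - k) ^ d * (p - k) ^ d"
  proof (rule mult_mono)
    have "k choose d \<le> k ^ d" by (rule binomial_le_power)
    also have "\<dots> \<le> (p - k) ^ d" using assms by (intro power_mono) auto
    finally show "k choose d \<le> (p - k) ^ d" .
  qed (simp_all add: binomial_le_power)
  also have "\<dots> = ((p - k)\<^sup>2) ^ d" by (simp add: power2_eq_square power_mult_distrib)
  finally show ?thesis .
qed

end

text \<open>Union bound grouped by the number \<open>d\<close> of missed ones. The failure bound for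
  each competitor is the \<open>d\<close>-th power of one number and so is the count, hence a
  geometric sum.\<close>

lemma (in gaussian_sample) failure_event_bound:
  assumes n: "n > 0" and \<sigma>: "\<sigma> \<ge> 0" and k: "k \<ge> 1" "p \<ge> 2 * k" and w: "w \<in> binary_vectors p" "l0_norm p w = k"
  defines "A \<equiv> 2 * pi\<^sup>2 * real k * (\<sigma>\<^sup>2 + 2)"
  shows "prob (failure_event M n p k w X E) \<le> (\<Sum>d=1..k. ((real (p - k))\<^sup>2 * exp (- (n / A))) ^ d)"
proof -
  let ?d = "\<lambda>v. card (support p w - support p v)"
  define F where "F v = {\<omega> \<in> space M. (\<Sum>i<n. score p w v (observation i \<omega>)) \<le> 0}" for v
  have F_meas: "F v \<in> events" for v
    using measurable_observation unfolding F_def by measurable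
  \<comment> \<open>As \<open>n > 0\<close>, the factor \<open>1 / n\<close> does not affect the
    sign of the error difference.\<close>
  have "failure_event M n p k w X E = (\<Union>v\<in>competitors p k w. F v)"
    using n by (auto simp: failure_event_def F_def competitors_def err_diff_def score_def observation_def
        mult_le_0_iff divide_le_0_iff)
  then have "prob (failure_event M n p k w X E) \<le> (\<Sum>v\<in>competitors p k w. prob (F v))"
    using F_meas by (auto intro!: finite_measure_subadditive_finite finite_competitors)
  also have "\<dots> \<le> (\<Sum>v\<in>competitors p k w. exp (- (n / A)) ^ ?d v)"
  proof (rule sum_mono)
    fix v assume v: "v \<in> competitors p k w"
    have d: "?d v \<ge> 1" using missed_bounds[OF w v] by simp
    let ?c = "sqrt (?d v / (k * (\<sigma>\<^sup>2 + 2))) / pi"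
    have "prob (F v) \<le> exp (- (n * ?c\<^sup>2 / 2))"
      unfolding F_def
    proof (rule score_concentration[OF n \<sigma>])
      show "?c \<le> (\<integral>z. score p w v z \<partial>sample_law p \<sigma>)"
        using v by (intro score_mean[OF \<sigma> w(1) _ w(2) _ refl d]) (auto simp: competitors_def)
    qed simp
    \<comment> \<open>Squaring the square-root gap makes the exponent linear in \<open>d\<close>;
      this fixes the value of \<open>A\<close>.\<close>
    also have "n * ?c\<^sup>2 / 2 = ?d v * (n / A)"
      by (simp add: A_def power_divide mult_ac)
    also have "exp (- (?d v * (n / A))) = exp (- (n / A)) ^ ?d v"
      by (simp flip: exp_of_nat_mult)
    finally show "prob (F v) \<le> exp (- (n / A)) ^ ?d v" .
  qed
  also have "\<dots> = (\<Sum>d=1..k. \<Sum>v | v \<in> competitors p k w \<and> ?d v = d. exp (- (n / A)) ^ ?d v)"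
    using missed_bounds[OF w] by (intro sum.group[symmetric] finite_competitors) auto
  also have "\<dots> \<le> (\<Sum>d=1..k. ((real (p - k))\<^sup>2 * exp (- (n / A))) ^ d)"
  proof (rule sum_mono)
    fix d
    have "(\<Sum>v | v \<in> competitors p k w \<and> ?d v = d. exp (- (n / A)) ^ ?d v)
      = real (card {v \<in> competitors p k w. ?d v = d}) * exp (- (n / A)) ^ d" by simp
    also have "\<dots> \<le> real (((p - k)\<^sup>2) ^ d) * exp (- (n / A)) ^ d"
      using card_competitors_missing[OF w k(2)] by (intro mult_right_mono) (auto simp only: of_nat_le_iff zero_le_power exp_ge_zero)
    finally show "(\<Sum>v | v \<in> competitors p k w \<and> ?d v = d. exp (- (n / A)) ^ ?d v)
      \<le> ((real (p - k))\<^sup>2 * exp (- (n / A))) ^ d" by (simp add: power_mult_distrib)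
  qed
  finally show ?thesis .
qed

section \<open>The geometric series and the threshold\<close>

lemma geometric_sum_le:
  fixes r :: real
  assumes "0 \<le> r" "r \<le> 1 / 2"
  shows "(\<Sum>d=1..k. r ^ d) \<le> 2 * r"
proof -
  \<comment> \<open>The sharper bound with \<open>1 - (1 / 2) ^ k\<close> is what carries the
    induction.\<close>
  have "(\<Sum>d=1..k. r ^ d) \<le> 2 * r * (1 - (1 / 2) ^ k)"
  proof (induction k)
    case (Suc k)
    have "r ^ Suc k \<le> r * (1 / 2) ^ k" using assms by (simp add: mult_left_mono power_mono)
    with Suc show ?case by (simp add: algebra_simps)
  qed simp
  also have "\<dots> \<le> 2 * r" using assms by (simp add: algebra_simps)
  finally show ?thesis .
qed

text \<open>\<open>n0\<close> is chosen so that the right-hand side equals \<open>2 * r\<close>,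
  where \<open>r\<close> is the ratio of the geometric sum. Beyond \<open>n0\<close> this value is
  at most one, so \<open>r \<le> 1 / 2\<close> and the sum is at most \<open>2 * r\<close>.\<close>

lemma (in gaussian_sample) failure_event_exp_bound:
  assumes \<sigma>: "\<sigma> \<ge> 0" and k: "k \<ge> 1" "p \<ge> 2 * k" and w: "w \<in> binary_vectors p" "l0_norm p w = k"
  defines "A \<equiv> 2 * pi\<^sup>2 * real k * (\<sigma>\<^sup>2 + 2)"
  defines "n0 \<equiv> A * ln (2 * (real (p - k))\<^sup>2)"
  assumes n: "real n > n0"
  shows "prob (failure_event M n p k w X E) \<le> exp (- ((real n - n0) / A))"
proof -
  have A: "A > 0" unfolding A_def using k by (simp add: add_nonneg_pos)
  have m: "real (p - k) \<ge> 1" using k by simp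
  then have "(real (p - k))\<^sup>2 \<ge> 1" by (simp add: one_le_power)
  \<comment> \<open>The factor \<open>2\<close> keeps the logarithm, and hence \<open>n0\<close>,
    positive even if \<open>p - k = 1\<close>.\<close>
  then have m2: "2 * (real (p - k))\<^sup>2 > 1" by linarith
  have "n0 > 0" unfolding n0_def using A m2 by (intro mult_pos_pos ln_gt_zero)
  with n have "n > 0" by simp
  define r where "r = (real (p - k))\<^sup>2 * exp (- (n / A))"
  have "exp (- ((real n - n0) / A)) = exp (ln (2 * (real (p - k))\<^sup>2) + - (n / A))"
    using A by (simp add: n0_def diff_divide_distrib)
  also have "\<dots> = 2 * (real (p - k))\<^sup>2 * exp (- (n / A))"
    using order.strict_trans[OF zero_less_one m2] by (simp only: exp_add exp_ln)
  finally have r: "exp (- ((real n - n0) / A)) = 2 * r" by (simp add: r_def)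
  have "exp (- ((real n - n0) / A)) \<le> 1" using n A by simp
  then have "r \<le> 1 / 2" using r by simp
  moreover have "r \<ge> 0" by (simp add: r_def)
  ultimately show ?thesis
    using failure_event_bound[OF \<open>n > 0\<close> \<sigma> k w] geometric_sum_le[of r k] unfolding r A_def[symmetric] r_def by linarith
qed

text \<open>For \<open>m \<ge> 2\<close> one has
  \<open>ln 2 + 2 * ln m \<le> 3 * ln m < 4 * ln m\<close>, which gives the constant
  \<open>8 = 2 * 4\<close>.\<close>

lemma threshold_bound:
  fixes m k \<sigma> :: real
  assumes "m \<ge> 2" "k > 0"
  shows "2 * pi\<^sup>2 * k * (\<sigma>\<^sup>2 + 2) * ln (2 * m\<^sup>2) < 8 * pi\<^sup>2 * (2 + \<sigma>\<^sup>2) * k * ln m"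
proof -
  have "ln (2 * m\<^sup>2) = ln 2 + 2 * ln m" using assms by (simp add: ln_mult ln_realpow)
  also have "\<dots> < 4 * ln m" using assms ln_le_cancel_iff[of 2 m] ln_gt_zero[of m] by linarith
  finally have "2 * pi\<^sup>2 * k * (\<sigma>\<^sup>2 + 2) * ln (2 * m\<^sup>2) < 2 * pi\<^sup>2 * k * (\<sigma>\<^sup>2 + 2) * (4 * ln m)"
    using assms by (intro mult_strict_left_mono) (auto simp: add_nonneg_pos)
  then show ?thesis by (simp add: algebra_simps)
qed

text \<open>The order of quantifiers makes \<open>C\<close> absolute and \<open>n0\<close>
  independent of \<open>n\<close> and of the sample. The guard \<open>p - k > 1\<close> on the size
  of \<open>n0\<close> excludes \<open>ln 1 = 0\<close>, below which no positive threshold can lie;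
  the last claim still covers that case.\<close>

theorem theorem4:
  "\<exists>C::real. C > 0 \<and>
    (\<forall>(p::nat) (k::nat) (\<sigma>::real) (w::nat \<Rightarrow> real).
      k \<ge> 1 \<longrightarrow> p \<ge> 2 * k \<longrightarrow> \<sigma> \<ge> 0 \<longrightarrow> w \<in> binary_vectors p \<longrightarrow> l0_norm p w = k \<longrightarrow>
      (\<exists>n0::real. n0 > 0 \<and>
        (\<forall>(n::nat) (M::'a measure) X E.
           real n > n0 \<longrightarrow> gaussian_sample M n p \<sigma> X E \<longrightarrow>
           measure M (failure_event M n p k w X E)
             \<le> exp (- ((real n - n0) / (2 * pi\<^sup>2 * real k * (\<sigma>\<^sup>2 + 2))))) \<and>
        (p - k > 1 \<longrightarrow> n0 < C * (2 + \<sigma>\<^sup>2) * real k * ln (real (p - k)))) \<and>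
      (\<forall>(\<delta>::real) (n::nat) (M::'a measure) X E.
         0 < \<delta> \<longrightarrow> \<delta> < 1 \<longrightarrow>
         real n \<ge> C * (2 + \<sigma>\<^sup>2) * real k * ln (real (p - k))
                   + 2 * pi\<^sup>2 * real k * (\<sigma>\<^sup>2 + 2) * ln (1 / \<delta>) \<longrightarrow>
         gaussian_sample M n p \<sigma> X E \<longrightarrow>
         measure M (failure_event M n p k w X E) \<le> \<delta>))"
proof (rule exI[of _ "8 * pi\<^sup>2"], intro conjI allI impI)
  show "8 * pi\<^sup>2 > 0" by simp
  fix p k :: nat and \<sigma> :: real and w :: "nat \<Rightarrow> real"
  assume k: "k \<ge> 1" "p \<ge> 2 * k" and \<sigma>: "\<sigma> \<ge> 0" and w: "w \<in> binary_vectors p" "l0_norm p w = k"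
  define A where "A = 2 * pi\<^sup>2 * real k * (\<sigma>\<^sup>2 + 2)"
  define n0 where "n0 = A * ln (2 * (real (p - k))\<^sup>2)"
  have A: "A > 0" unfolding A_def using k by (simp add: add_nonneg_pos)
  have "(real (p - k))\<^sup>2 \<ge> 1" using k by (simp add: one_le_power)
  then have "2 * (real (p - k))\<^sup>2 > 1" by linarith
  then have n0: "n0 > 0" unfolding n0_def using A by (intro mult_pos_pos ln_gt_zero)
  have bound: "measure M (failure_event M n p k w X E) \<le> exp (- ((real n - n0) / A))"
    if "real n > n0" "gaussian_sample M n p \<sigma> X E" for n X E and M :: "'a measure"
    using gaussian_sample.failure_event_exp_bound[OF that(2) \<sigma> k w] that(1) by (simp add: n0_def A_def)
  have n0_less: "n0 < 8 * pi\<^sup>2 * (2 + \<sigma>\<^sup>2) * real k * ln (real (p - k))" if "p - k > 1"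
    using threshold_bound[of "real (p - k)" "real k" \<sigma>] that k by (simp add: n0_def A_def)
  show "\<exists>n0::real. n0 > 0 \<and>
        (\<forall>(n::nat) (M::'a measure) X E.
           real n > n0 \<longrightarrow> gaussian_sample M n p \<sigma> X E \<longrightarrow>
           measure M (failure_event M n p k w X E)
             \<le> exp (- ((real n - n0) / (2 * pi\<^sup>2 * real k * (\<sigma>\<^sup>2 + 2))))) \<and>
        (p - k > 1 \<longrightarrow> n0 < 8 * pi\<^sup>2 * (2 + \<sigma>\<^sup>2) * real k * ln (real (p - k)))"
    using n0 bound n0_less unfolding A_def by blast
  fix \<delta> :: real and n X E and M :: "'a measure"
  assume \<delta>: "0 < \<delta>" "\<delta> < 1" and gs: "gaussian_sample M n p \<sigma> X E"
    and n: "real n \<ge> 8 * pi\<^sup>2 * (2 + \<sigma>\<^sup>2) * real k * ln (real (p - k))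
                   + 2 * pi\<^sup>2 * real k * (\<sigma>\<^sup>2 + 2) * ln (1 / \<delta>)"
  \<comment> \<open>Positive since \<open>\<delta> < 1\<close>; it places \<open>n\<close> strictly
    beyond \<open>n0\<close> in the first case and excludes \<open>n = 0\<close> in the
    second.\<close>
  have l: "A * ln (1 / \<delta>) > 0" using A \<delta> by (simp add: ln_gt_zero)
  show "measure M (failure_event M n p k w X E) \<le> \<delta>"
  proof (cases "p - k > 1")
    case True
    have n1: "real n > n0 + A * ln (1 / \<delta>)" using n n0_less[OF True] by (simp add: A_def)
    then have "measure M (failure_event M n p k w X E) \<le> exp (- ((real n - n0) / A))"
      using l gs by (intro bound) auto
    also have "\<dots> \<le> exp (- ln (1 / \<delta>))"
      using n1 A by (simp add: pos_le_divide_eq algebra_simps)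
    also have "\<dots> = \<delta>" using \<delta> by (simp add: ln_div)
    finally show ?thesis .
  next
    case False
    \<comment> \<open>Here \<open>ln (p - k) = 0 < n0\<close>, so the threshold does not help; but there is a single
      competitor, and the union bound costs nothing.\<close>
    then have pk: "p - k = 1" "k = 1" using k by linarith+
    then have n1: "real n \<ge> A * ln (1 / \<delta>)" using n by (simp add: A_def)
    then have "n > 0" using l by (cases n) auto
    then have "measure M (failure_event M n p k w X E) \<le> (\<Sum>d=1..k. ((real (p - k))\<^sup>2 * exp (- (n / A))) ^ d)"
      using gaussian_sample.failure_event_bound[OF gs _ \<sigma> k w] by (simp only: A_def)
    \<comment> \<open>Only \<open>d = 1\<close> occurs, with a single competitor counted, so no
      factor has to be absorbed by a threshold.\<close>
    also have "\<dots> = exp (- (n / A))"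
      by (simp only: pk(1)) (simp add: pk(2))
    also have "\<dots> \<le> exp (- ln (1 / \<delta>))"
      using n1 A by (simp add: pos_le_divide_eq mult.commute)
    also have "\<dots> = \<delta>" using \<delta> by (simp add: ln_div)
    finally show ?thesis .
  qed
qed

end
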